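(* Let $A$ be a $C^*$-algebra of compact operators, let $U$ and $V$ be Hilbert $A$-modules, and let $F\in\mathrm{Hom}_{H_A^*}(U,V)$. Then $F$ is an $A$-Fredholm operator if and only if its image is closed and $\dim_A\mathrm{Ker}\,F$ and $\dim_A(\mathrm{Im}\,F)^{\perp}$ are finite.
   Context: A $C^*$-algebra of compact operators is a $C^*$-subalgebra of the algebra $K(H)$ of compact operators on some (not necessarily separable) Hilbert space $H$. A Hilbert $A$-module is a complex vector space $U$ that is a right $A$-module (action denoted by a dot) with a map (the $A$-product) $(\,,):U\times U\to A$ such that $(u,zv+w)=z(u,v)+(u,w)$, $(u,v\cdot a)=(u,v)a$, $(u,v)=(v,u)^*$, $(u,u)\ge 0$, and $(u,u)=0$ implies $u=0$, for $u,v,w\in U$, $a\in A$, $z\in\mathbb{C}$, and that is complete in the norm $|u|=\sqrt{|(u,u)|_A}$. $H_A^*$ is the category of Hilbert $A$-modules with morphisms the continuous $A$-linear maps $L:U\to V$ that are adjointable, i.e. there is $L^*:V\to U$ with $(Lu,v)_V=(u,L^*v)_U$ for all $u\in U$, $v\in V$. For a subset $S\subseteq V$, $S^\perp=\{v\in V: (v,s)=0 \text{ for all } s\in S\}$. For $u\in U$, $v\in V$, the elementary operator $F_{u,v}:U\to V$ is $F_{u,v}(u')=v\cdot(u,u')$. A morphism in $H_A^*$ is of $A$-finite rank if it is a finite sum of $A$-linear combinations of elementary operators (equivalently, a finite sum of elementary operators); it is $A$-compact if it lies in the operator norm closure in $\mathrm{Hom}_{H_A^*}(U,V)$ of the $A$-finite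 rank morphisms. A morphism $F:U\to V$ in $H_A^*$ is $A$-Fredholm if there exist morphisms $G_U,G_V:V\to U$ in $H_A^*$ and $A$-compact morphisms $P_U:U\to U$, $P_V:V\to V$ with $G_UF=1_U+P_U$ and $FG_V=1_V+P_V$. Dimension (Bakić–Guljaš): for a Hilbert module $U$ over a $C^*$-algebra $A$ of compact operators, an orthonormal system (basis) is a family of elements $(u_j)$ of $U$ such that each $(u_j,u_j)$ is a minimal projection $e_j\in A$ (a nonzero projection with $e_jAe_j=\mathbb{C}e_j$), $(u_j,u_k)=0$ for $j\ne k$, and the $u_j$ generate a dense $A$-submodule of $U$. Such systems exist and all have the same cardinality, which is denoted $\dim_A U$. *)

theory Defs
  imports "HOL-Analysis.Analysis"
begin

section \<open>Complex normed spaces and Hilbert spaces\<close>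

class complex_vector = real_vector +
  fixes scaleC :: "complex \<Rightarrow> 'a \<Rightarrow> 'a"  (infixr "*\<^sub>C" 75)
  assumes scaleC_add_right: "z *\<^sub>C (x + y) = z *\<^sub>C x + z *\<^sub>C y"
    and scaleC_add_left: "(z + w) *\<^sub>C x = z *\<^sub>C x + w *\<^sub>C x"
    and scaleC_scaleC: "z *\<^sub>C w *\<^sub>C x = (z * w) *\<^sub>C x"
    and scaleC_of_real: "of_real r *\<^sub>C x = r *\<^sub>R x"

class complex_normed_vector = complex_vector + real_normed_vector +
  assumes norm_scaleC: "norm (z *\<^sub>C x) = norm z * norm x"

text \<open>Positive definiteness of \<^term>\<open>cinner\<close> and the formula for the norm are inherited from
  \<^class>\<open>real_inner\<close>, the real inner product being the real part of \<^term>\<open>cinner\<close>.\<close>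

class chilbert_space = complex_vector + real_inner + complete_space +
  fixes cinner :: "'a \<Rightarrow> 'a \<Rightarrow> complex"
  assumes cinner_commute: "cinner x y = cnj (cinner y x)"
    and cinner_add_right: "cinner x (y + y') = cinner x y + cinner x y'"
    and cinner_scaleC_right: "cinner x (z *\<^sub>C y) = z * cinner x y"
    and inner_eq_Re_cinner: "inner x y = Re (cinner x y)"
begin

subclass complex_normed_vector
proof
  fix z :: complex and x :: 'a
  have "cinner (z *\<^sub>C x) (z *\<^sub>C x) = z * cnj z * cinner x x"
    by (metis cinner_commute cinner_scaleC_right complex_cnj_mult mult.assoc)
  also have "\<dots> = of_real ((norm z)\<^sup>2) * cinner x x"
    by (metis complex_norm_square)
  finally have "inner (z *\<^sub>C x) (z *\<^sub>C x) = (norm z)\<^sup>2 * inner x x"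
    by (simp add: inner_eq_Re_cinner)
  then show "norm (z *\<^sub>C x) = norm z * norm x"
    by (simp add: norm_eq_sqrt_inner real_sqrt_mult)
qed

end

instantiation complex :: chilbert_space
begin

definition scaleC_complex :: "complex \<Rightarrow> complex \<Rightarrow> complex"
  where "scaleC_complex = (*)"

definition cinner_complex :: "complex \<Rightarrow> complex \<Rightarrow> complex"
  where "cinner_complex x y = cnj x * y"

instance
  by standard
    (auto simp: scaleC_complex_def cinner_complex_def inner_complex_def
      algebra_simps scaleR_conv_of_real)

end

instantiation blinfun :: (real_normed_vector, complex_normed_vector) complex_normed_vector
begin

lift_definition scaleC_blinfun :: "complex \<Rightarrow> ('a \<Rightarrow>\<^sub>L 'b) \<Rightarrow> ('a \<Rightarrow>\<^sub>L 'b)"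
  is "\<lambda>z f x. z *\<^sub>C f x"
proof -
  fix z :: complex and f :: "'a \<Rightarrow> 'b"
  assume f: "bounded_linear f"
  have "bounded_linear (\<lambda>y::'b. z *\<^sub>C y)"
    by (rule bounded_linear_intro[where K = "norm z"])
      (auto simp: scaleC_add_right norm_scaleC mult.commute scaleC_scaleC
        simp flip: scaleC_of_real)
  then show "bounded_linear (\<lambda>x. z *\<^sub>C f x)"
    using f by (rule bounded_linear_compose)
qed

instance
proof
  fix z w :: complex and r :: real and f g :: "'a \<Rightarrow>\<^sub>L 'b"
  show "z *\<^sub>C (f + g) = z *\<^sub>C f + z *\<^sub>C g"
    by transfer (simp add: scaleC_add_right)
  show "(z + w) *\<^sub>C f = z *\<^sub>C f + w *\<^sub>C f"
    by transfer (simp add: scaleC_add_left)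
  show "z *\<^sub>C w *\<^sub>C f = (z * w) *\<^sub>C f"
    by transfer (simp add: scaleC_scaleC)
  show "of_real r *\<^sub>C f = r *\<^sub>R f"
    by transfer (simp add: scaleC_of_real)
  show "norm (z *\<^sub>C f) = norm z * norm f"
  proof transfer
    fix z :: complex and f :: "'a \<Rightarrow> 'b"
    assume f: "bounded_linear f"
    have "onorm (\<lambda>x. z *\<^sub>C f x) = onorm (\<lambda>x. norm z *\<^sub>R f x)"
      by (simp add: onorm_def norm_scaleC)
    then show "onorm (\<lambda>x. z *\<^sub>C f x) = norm z * onorm f"
      using onorm_scaleR[OF f, of "norm z"] by simp
  qed
qed

end


section \<open>Algebras of operators on a Hilbert space\<close>

text \<open>The type \<^typ>\<open>'a \<Rightarrow>\<^sub>L 'b\<close> consists of the bounded \<^emph>\<open>real\<close>-linear maps; complex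
  homogeneity is therefore always required separately.\<close>

definition complex_homogeneous ::
    "('a::complex_normed_vector \<Rightarrow>\<^sub>L 'b::complex_normed_vector) \<Rightarrow> bool"
  where "complex_homogeneous T \<longleftrightarrow> (\<forall>z x. T (z *\<^sub>C x) = z *\<^sub>C T x)"

definition is_adjoint ::
    "('h::chilbert_space \<Rightarrow>\<^sub>L 'h) \<Rightarrow> ('h \<Rightarrow>\<^sub>L 'h) \<Rightarrow> bool"
  where "is_adjoint S T \<longleftrightarrow> (\<forall>x y. cinner (S x) y = cinner x (T y))"

definition positive_operator :: "('h::chilbert_space \<Rightarrow>\<^sub>L 'h) \<Rightarrow> bool"
  where "positive_operator T \<longleftrightarrow> (\<forall>x. cinner x (T x) \<in> \<real>\<^sub>\<ge>\<^sub>0)"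

definition compact_operator ::
    "('a::real_normed_vector \<Rightarrow>\<^sub>L 'b::real_normed_vector) \<Rightarrow> bool"
  where "compact_operator T \<longleftrightarrow> compact (closure (T ` cball 0 1))"

locale operator_cstar_algebra =
  fixes A :: "('h::chilbert_space \<Rightarrow>\<^sub>L 'h) set"
  assumes homogeneous: "a \<in> A \<Longrightarrow> complex_homogeneous a"
    and zero_closed: "0 \<in> A"
    and add_closed: "\<lbrakk>a \<in> A; b \<in> A\<rbrakk> \<Longrightarrow> a + b \<in> A"
    and scaleC_closed: "a \<in> A \<Longrightarrow> z *\<^sub>C a \<in> A"
    and compose_closed: "\<lbrakk>a \<in> A; b \<in> A\<rbrakk> \<Longrightarrow> a o\<^sub>L b \<in> A"
    and adjoint_closed: "a \<in> A \<Longrightarrow> \<exists>b\<in>A. is_adjoint b a"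
    and norm_closed: "closed A"

locale compact_operator_cstar_algebra = operator_cstar_algebra +
  assumes compact: "a \<in> A \<Longrightarrow> compact_operator a"

definition minimal_projection ::
    "('h::chilbert_space \<Rightarrow>\<^sub>L 'h) set \<Rightarrow> ('h \<Rightarrow>\<^sub>L 'h) \<Rightarrow> bool"
  where "minimal_projection A e \<longleftrightarrow>
    e \<in> A \<and> e \<noteq> 0 \<and> e o\<^sub>L e = e \<and> is_adjoint e e \<and>
    {e o\<^sub>L a o\<^sub>L e | a. a \<in> A} = {z *\<^sub>C e | z. True}"


section \<open>Hilbert modules\<close>

text \<open>The module is the whole type \<^typ>\<open>'u\<close>, whose norm is required to be the one induced by
  the \<open>A\<close>-valued product; completeness in this norm is \<^class>\<open>banach\<close>. The values of
  \<open>act\<close> at operators outside \<open>A\<close> are irrelevant.\<close>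

locale hilbert_module = operator_cstar_algebra A
  for A :: "('h::chilbert_space \<Rightarrow>\<^sub>L 'h) set" +
  fixes act :: "'u::{complex_normed_vector, banach} \<Rightarrow> ('h \<Rightarrow>\<^sub>L 'h) \<Rightarrow> 'u"
    and ip :: "'u \<Rightarrow> 'u \<Rightarrow> ('h \<Rightarrow>\<^sub>L 'h)"
  assumes act_add_left: "a \<in> A \<Longrightarrow> act (u + v) a = act u a + act v a"
    and act_add_right: "\<lbrakk>a \<in> A; b \<in> A\<rbrakk> \<Longrightarrow> act u (a + b) = act u a + act u b"
    and act_compose: "\<lbrakk>a \<in> A; b \<in> A\<rbrakk> \<Longrightarrow> act u (a o\<^sub>L b) = act (act u a) b"
    and act_scaleC_left: "a \<in> A \<Longrightarrow> act (z *\<^sub>C u) a = z *\<^sub>C act u a"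
    and act_scaleC_right: "a \<in> A \<Longrightarrow> act u (z *\<^sub>C a) = z *\<^sub>C act u a"
    and ip_in: "ip u v \<in> A"
    and ip_linear: "ip u (z *\<^sub>C v + w) = z *\<^sub>C ip u v + ip u w"
    and ip_act: "a \<in> A \<Longrightarrow> ip u (act v a) = ip u v o\<^sub>L a"
    and ip_adjoint: "is_adjoint (ip u v) (ip v u)"
    and ip_positive: "positive_operator (ip u u)"
    and ip_definite: "ip u u = 0 \<Longrightarrow> u = 0"
    and norm_eq: "norm u = sqrt (norm (ip u u))"

definition submodule ::
    "('h::chilbert_space \<Rightarrow>\<^sub>L 'h) set \<Rightarrow>
     ('u::complex_normed_vector \<Rightarrow> ('h \<Rightarrow>\<^sub>L 'h) \<Rightarrow> 'u) \<Rightarrow> 'u set \<Rightarrow> bool"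
  where "submodule A act W \<longleftrightarrow>
    0 \<in> W \<and> (\<forall>u\<in>W. \<forall>v\<in>W. u + v \<in> W) \<and> (\<forall>z. \<forall>u\<in>W. z *\<^sub>C u \<in> W) \<and>
    (\<forall>u\<in>W. \<forall>a\<in>A. act u a \<in> W)"

definition orthocomplement :: "('u \<Rightarrow> 'u \<Rightarrow> ('h::chilbert_space \<Rightarrow>\<^sub>L 'h)) \<Rightarrow> 'u set \<Rightarrow> 'u set"
  where "orthocomplement ip S = {v. \<forall>s\<in>S. ip v s = 0}"

text \<open>Orthonormal bases and dimension are defined for closed submodules \<open>W\<close>, regarded as Hilbert
  modules with the restricted operations; the whole module is the case \<^term>\<open>W = UNIV\<close>. Since
  \<open>ip u u \<noteq> 0\<close> for every member of an orthonormal system, its members are pairwise distinct, so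
  that a system may be represented by a set.\<close>

definition orthonormal_basis ::
    "('h::chilbert_space \<Rightarrow>\<^sub>L 'h) set \<Rightarrow>
     ('u::complex_normed_vector \<Rightarrow> ('h \<Rightarrow>\<^sub>L 'h) \<Rightarrow> 'u) \<Rightarrow>
     ('u \<Rightarrow> 'u \<Rightarrow> ('h \<Rightarrow>\<^sub>L 'h)) \<Rightarrow> 'u set \<Rightarrow> 'u set \<Rightarrow> bool"
  where "orthonormal_basis A act ip W B \<longleftrightarrow>
    B \<subseteq> W \<and>
    (\<forall>u\<in>B. minimal_projection A (ip u u)) \<and>
    (\<forall>u\<in>B. \<forall>v\<in>B. u \<noteq> v \<longrightarrow> ip u v = 0) \<and>
    W \<subseteq> closure (submodule A act hull B)"

text \<open>The dimension is a cardinal number. All orthonormal bases of a Hilbert module over an algebra of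
  compact operators have the same cardinality, so the choice of the basis is immaterial.\<close>

definition module_dim ::
    "('h::chilbert_space \<Rightarrow>\<^sub>L 'h) set \<Rightarrow>
     ('u::complex_normed_vector \<Rightarrow> ('h \<Rightarrow>\<^sub>L 'h) \<Rightarrow> 'u) \<Rightarrow>
     ('u \<Rightarrow> 'u \<Rightarrow> ('h \<Rightarrow>\<^sub>L 'h)) \<Rightarrow> 'u set \<Rightarrow> 'u rel"
  where "module_dim A act ip W = card_of (SOME B. orthonormal_basis A act ip W B)"


section \<open>Morphisms\<close>

definition adjointable_hom ::
    "('h::chilbert_space \<Rightarrow>\<^sub>L 'h) set \<Rightarrow>
     ('u::complex_normed_vector \<Rightarrow> ('h \<Rightarrow>\<^sub>L 'h) \<Rightarrow> 'u) \<Rightarrow> ('u \<Rightarrow> 'u \<Rightarrow> ('h \<Rightarrow>\<^sub>L 'h)) \<Rightarrow>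
     ('v::complex_normed_vector \<Rightarrow> ('h \<Rightarrow>\<^sub>L 'h) \<Rightarrow> 'v) \<Rightarrow> ('v \<Rightarrow> 'v \<Rightarrow> ('h \<Rightarrow>\<^sub>L 'h)) \<Rightarrow>
     ('u \<Rightarrow>\<^sub>L 'v) set"
  where "adjointable_hom A actU ipU actV ipV =
    {L. complex_homogeneous L \<and>
        (\<forall>u. \<forall>a\<in>A. L (actU u a) = actV (L u) a) \<and>
        (\<exists>M :: 'v \<Rightarrow> 'u. \<forall>u v. ipV (L u) v = ipU u (M v))}"

definition elementary ::
    "('u \<Rightarrow> 'u \<Rightarrow> ('h::chilbert_space \<Rightarrow>\<^sub>L 'h)) \<Rightarrow> ('v \<Rightarrow> ('h \<Rightarrow>\<^sub>L 'h) \<Rightarrow> 'v) \<Rightarrow>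
     'u \<Rightarrow> 'v \<Rightarrow> 'u \<Rightarrow> 'v"
  where "elementary ipU actV u v = (\<lambda>u'. actV v (ipU u u'))"

definition finite_rank_hom ::
    "('h::chilbert_space \<Rightarrow>\<^sub>L 'h) set \<Rightarrow>
     ('u::complex_normed_vector \<Rightarrow> ('h \<Rightarrow>\<^sub>L 'h) \<Rightarrow> 'u) \<Rightarrow> ('u \<Rightarrow> 'u \<Rightarrow> ('h \<Rightarrow>\<^sub>L 'h)) \<Rightarrow>
     ('v::complex_normed_vector \<Rightarrow> ('h \<Rightarrow>\<^sub>L 'h) \<Rightarrow> 'v) \<Rightarrow> ('v \<Rightarrow> 'v \<Rightarrow> ('h \<Rightarrow>\<^sub>L 'h)) \<Rightarrow>
     ('u \<Rightarrow>\<^sub>L 'v) set"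
  where "finite_rank_hom A actU ipU actV ipV =
    {L \<in> adjointable_hom A actU ipU actV ipV.
      \<exists>(n::nat) u v. \<forall>x. L x = (\<Sum>i<n. elementary ipU actV (u i) (v i) x)}"

definition compact_hom ::
    "('h::chilbert_space \<Rightarrow>\<^sub>L 'h) set \<Rightarrow>
     ('u::complex_normed_vector \<Rightarrow> ('h \<Rightarrow>\<^sub>L 'h) \<Rightarrow> 'u) \<Rightarrow> ('u \<Rightarrow> 'u \<Rightarrow> ('h \<Rightarrow>\<^sub>L 'h)) \<Rightarrow>
     ('v::complex_normed_vector \<Rightarrow> ('h \<Rightarrow>\<^sub>L 'h) \<Rightarrow> 'v) \<Rightarrow> ('v \<Rightarrow> 'v \<Rightarrow> ('h \<Rightarrow>\<^sub>L 'h)) \<Rightarrow>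
     ('u \<Rightarrow>\<^sub>L 'v) set"
  where "compact_hom A actU ipU actV ipV =
    adjointable_hom A actU ipU actV ipV \<inter> closure (finite_rank_hom A actU ipU actV ipV)"

definition fredholm_hom ::
    "('h::chilbert_space \<Rightarrow>\<^sub>L 'h) set \<Rightarrow>
     ('u::complex_normed_vector \<Rightarrow> ('h \<Rightarrow>\<^sub>L 'h) \<Rightarrow> 'u) \<Rightarrow> ('u \<Rightarrow> 'u \<Rightarrow> ('h \<Rightarrow>\<^sub>L 'h)) \<Rightarrow>
     ('v::complex_normed_vector \<Rightarrow> ('h \<Rightarrow>\<^sub>L 'h) \<Rightarrow> 'v) \<Rightarrow> ('v \<Rightarrow> 'v \<Rightarrow> ('h \<Rightarrow>\<^sub>L 'h)) \<Rightarrow>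
     ('u \<Rightarrow>\<^sub>L 'v) set"
  where "fredholm_hom A actU ipU actV ipV =
    {F \<in> adjointable_hom A actU ipU actV ipV.
      \<exists>GU \<in> adjointable_hom A actV ipV actU ipU. \<exists>GV \<in> adjointable_hom A actV ipV actU ipU.
      \<exists>PU \<in> compact_hom A actU ipU actU ipU. \<exists>PV \<in> compact_hom A actV ipV actV ipV.
        GU o\<^sub>L F = id_blinfun + PU \<and> F o\<^sub>L GV = id_blinfun + PV}"

end

theory Submission
  imports Defs
begin

text \<open>
  The key point is that closed submodules over an algebra \<open>A\<close> of compact operators are complemented.
  A self-adjoint contraction \<open>c \<in> A\<close> of norm \<open>1\<close> has even powers converging in norm to a nonzero
  projection, and descending chains of projections in \<open>A\<close> stop; so every nonzero module element \<open>z\<close> has a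
  multiple \<open>z \<cdot> e\<close> that normalises to a vector with \<open>(u, u)\<close> a minimal projection. Since \<open>(y, y)\<close> is compact,
  the expansion of \<open>y\<close> in an orthonormal system converges in norm. Hence a maximal orthonormal system of a
  closed submodule is a basis and the expansion gives the orthogonal projection.

  If \<open>F\<close> is Fredholm, a compact \<open>P\<close> has norm at most \<open>1/2\<close> on the complement of a finite orthonormal system, where
  \<open>F\<close> is therefore bounded below; the rest of the range adds finitely many submodules \<open>y \<cdot> A\<close> with \<open>y = y \<cdot> e\<close>, which
  does not destroy closedness. An orthonormal system on which \<open>(u, u + P u) = 0\<close> is finite, because the
  coefficients of any fixed element tend to \<open>0\<close>; this bounds both dimensions. Conversely, by the open mapping
  argument \<open>F\<close> has bounded preimages, so \<open>F\<close> and its adjoint are inverted between the complement of the kernel and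
  the image, and these inverses compose with the projections to a parametrix and its adjoint.
\<close>

section \<open>Compact operators and minimal projections\<close>

text \<open>Finitely many of the balls around the points \<open>K x\<close>, with \<open>x\<close>
  in the unit ball, already cover the closure. This is the form in which compactness is used:
  estimates over the whole unit ball reduce to finitely many vectors.\<close>

lemma compact_operator_net:
  fixes K :: "'a::real_normed_vector \<Rightarrow>\<^sub>L 'b::real_normed_vector"
  assumes "compact_operator K" "d > 0"
  obtains X where "finite X" "X \<subseteq> cball 0 1"
    "\<And>x. norm x \<le> 1 \<Longrightarrow> \<exists>y\<in>X. norm (K (x - y)) < d"
proof -
  have "closure (K ` cball 0 1) \<subseteq> (\<Union>x\<in>cball 0 1. ball (K x) d)"
  proof
    fix z assume "z \<in> closure (K ` cball 0 1)"
    then obtain x where "x \<in> cball 0 1" "dist (K x) z < d"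
      using assms(2) unfolding closure_approachable by blast
    then show "z \<in> (\<Union>x\<in>cball 0 1. ball (K x) d)" by auto
  qed
  then obtain X where X: "X \<subseteq> cball 0 1" "finite X"
      "closure (K ` cball 0 1) \<subseteq> (\<Union>x\<in>X. ball (K x) d)"
    using assms(1) unfolding compact_operator_def
    by (elim compactE_image[of _ "cball 0 1" "\<lambda>x. ball (K x) d"]) auto
  have "\<exists>y\<in>X. norm (K (x - y)) < d" if "norm x \<le> 1" for x
  proof -
    have "K x \<in> closure (K ` cball 0 1)"
      using that by (intro subsetD[OF closure_subset]) auto
    then have "K x \<in> (\<Union>y\<in>X. ball (K y) d)"
      using X(3) by blast
    then obtain y where "y \<in> X" "dist (K y) (K x) < d"
      by auto
    then show ?thesis
      by (auto simp: dist_norm norm_minus_commute blinfun.diff_right)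
  qed
  with X that show thesis by blast
qed

text \<open>Phrased with the real inner product; for complex homogeneous operators it agrees with
  \<open>is_adjoint a a\<close>, as \<open>is_adjoint_self_iff\<close> shows.\<close>

definition self_adjoint :: "('a::real_inner \<Rightarrow>\<^sub>L 'a) \<Rightarrow> bool"
  where "self_adjoint T \<longleftrightarrow> (\<forall>x y. T x \<bullet> y = x \<bullet> T y)"

text \<open>Multiplying \<open>y\<close> by \<open>\<i>\<close> turns the imaginary part of the
  complex product into minus a real part, so the real product determines the complex one.\<close>

lemma cinner_eq_inner:
  fixes x y :: "'h::chilbert_space"
  shows "cinner x y = Complex (x \<bullet> y) (- (x \<bullet> (\<i> *\<^sub>C y)))"
  by (simp add: complex_eq_iff inner_eq_Re_cinner cinner_scaleC_right)

text \<open>The imaginary parts agree because the real identity may be applied to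
  \<open>\<i> *\<^sub>C y\<close>, and homogeneity moves \<open>\<i>\<close> past
  \<open>T\<close>.\<close>

lemma is_adjoint_iff_inner:
  assumes "complex_homogeneous (T :: 'h::chilbert_space \<Rightarrow>\<^sub>L 'h)"
  shows "is_adjoint S T \<longleftrightarrow> (\<forall>x y. S x \<bullet> y = x \<bullet> T y)"
proof -
  have "T (\<i> *\<^sub>C y) = \<i> *\<^sub>C T y" for y
    using assms by (simp add: complex_homogeneous_def)
  then show ?thesis
    unfolding is_adjoint_def cinner_eq_inner by (metis complex.inject)
qed

lemma is_adjointD: "is_adjoint S T \<Longrightarrow> S x \<bullet> y = x \<bullet> T y"
  by (simp add: is_adjoint_def inner_eq_Re_cinner)

lemma is_adjoint_unique:
  assumes "is_adjoint S T" "is_adjoint S' T"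
  shows "S = S'"
  by (rule blinfun_eqI) (metis assms is_adjointD inner_commute vector_eq_rdot)

lemma is_adjoint_commute: "is_adjoint S T \<Longrightarrow> is_adjoint T S"
  unfolding is_adjoint_def by (metis cinner_commute)

lemma norm_adjoint_le:
  fixes S T :: "'a::real_inner \<Rightarrow>\<^sub>L 'a"
  assumes "\<And>x y. S x \<bullet> y = x \<bullet> T y"
  shows "norm S \<le> norm T"
proof (rule norm_blinfun_bound)
  fix x
  have "norm (S x) ^ 2 = x \<bullet> T (S x)"
    by (metis assms power2_norm_eq_inner)
  also have "\<dots> \<le> norm x * norm (T (S x))"
    by (rule norm_cauchy_schwarz)
  also have "\<dots> \<le> norm x * (norm T * norm (S x))"
    by (simp add: mult_left_mono norm_blinfun)
  finally show "norm (S x) \<le> norm T * norm x"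
    by (cases "S x = 0") (simp_all add: power2_eq_square mult_ac)
qed simp

lemma norm_is_adjoint: "is_adjoint S T \<Longrightarrow> norm S = norm T"
  by (metis is_adjointD is_adjoint_commute norm_adjoint_le order_antisym)

lemma positive_operatorD: "positive_operator T \<Longrightarrow> 0 \<le> x \<bullet> T x"
  by (simp add: positive_operator_def inner_eq_Re_cinner complex_nonneg_Reals_iff)

text \<open>The C*-identity: the square of the norm of \<open>T x\<close> is the product of
  \<open>x\<close> with \<open>T (T x)\<close>.\<close>

lemma norm_self_adjoint_square:
  fixes T :: "'a::real_inner \<Rightarrow>\<^sub>L 'a"
  assumes "self_adjoint T"
  shows "norm (T o\<^sub>L T) = norm T ^ 2"
proof (rule antisym)
  show "norm (T o\<^sub>L T) \<le> norm T ^ 2"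
    by (metis norm_blinfun_compose power2_eq_square)
  have "norm T \<le> sqrt (norm (T o\<^sub>L T))"
  proof (rule norm_blinfun_bound)
    fix x
    have "norm (T x) ^ 2 = x \<bullet> T (T x)"
      using assms by (metis self_adjoint_def power2_norm_eq_inner)
    also have "\<dots> \<le> norm x * norm ((T o\<^sub>L T) x)"
      by (simp add: norm_cauchy_schwarz)
    also have "\<dots> \<le> norm x * (norm (T o\<^sub>L T) * norm x)"
      by (simp only: mult_left_mono norm_blinfun norm_ge_zero)
    finally have "norm (T x) ^ 2 \<le> norm (T o\<^sub>L T) * norm x ^ 2"
      by (simp add: power2_eq_square mult_ac)
    then show "norm (T x) \<le> sqrt (norm (T o\<^sub>L T)) * norm x"
      by (metis norm_ge_zero real_le_rsqrt real_sqrt_mult real_sqrt_abs abs_of_nonneg)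
  qed simp
  then show "norm T ^ 2 \<le> norm (T o\<^sub>L T)"
    by (metis norm_ge_zero power_mono real_sqrt_pow2)
qed

text \<open>The even powers of a self-adjoint contraction \<open>c\<close> converge strongly because
  \<open>\<parallel>c\<^sup>k x\<parallel>\<close> decreases with \<open>k\<close>; compactness makes the convergence uniform.\<close>

lemma Cauchy_self_adjoint_powers:
  fixes c :: "'h::chilbert_space \<Rightarrow>\<^sub>L 'h"
  assumes c: "self_adjoint c" "norm c \<le> 1" and K: "compact_operator c"
  shows "Cauchy (\<lambda>n. ((\<lambda>T. (c o\<^sub>L c) o\<^sub>L T) ^^ n) (c o\<^sub>L c))"
proof -
  \<comment> \<open>\<open>t n\<close> is \<open>c\<close> to the power \<open>2 * n + 2\<close>.
    Starting at the square instead of the identity keeps every term inside the algebra generated by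
    \<open>c\<close> and lets every term factor through the compact \<open>c\<close>.\<close>
  define t where "t n = ((\<lambda>T. (c o\<^sub>L c) o\<^sub>L T) ^^ n) (c o\<^sub>L c)" for n
  define p where "p n = blinfun_apply c ^^ n" for n
  have t: "blinfun_apply (t n) = p (2 * n + 2)" for n
    by (induction n) (auto simp: t_def p_def numeral_2_eq_2)
  have p_add: "p m (p n x) = p (m + n) x" for m n x
    by (simp add: p_def funpow_add)
  have p_diff: "p n (x - y) = p n x - p n y" for n x y
    by (induction n) (auto simp: p_def blinfun.diff_right)
  have contr: "norm (c x) \<le> norm x" for x
    using norm_blinfun[of c x] mult_right_mono[OF c(2), of "norm x"] by simp
  have p_contr: "norm (p n x) \<le> norm x" for n x
    by (induction n) (auto simp: p_def intro: order_trans[OF contr])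
  have p_sa: "p n x \<bullet> y = x \<bullet> p n y" for n x y
    by (induction n arbitrary: x y)
      (use c(1) in \<open>simp_all add: p_def self_adjoint_def funpow_swap1\<close>)
  have strong: "Cauchy (\<lambda>n. p (2 * n) x)" for x
  proof -
    define r where "r k = norm (p k x) ^ 2" for k
    have "decseq r"
      unfolding decseq_Suc_iff r_def by (simp add: p_def contr power_mono)
    then obtain l where l: "r \<longlonglongrightarrow> l"
      using decseq_convergent[of r 0] by (auto simp: r_def)
    show ?thesis
    proof (rule CauchyI)
      fix e :: real assume "e > 0"
      then have "\<forall>\<^sub>F k in sequentially. dist (r k) l < e^2 / 4"
        using l by (intro tendstoD) auto
      then obtain N where N: "\<And>k. k \<ge> N \<Longrightarrow> \<bar>r k - l\<bar> < e^2 / 4"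
        unfolding eventually_sequentially dist_real_def by blast
      have "norm (p (2 * m) x - p (2 * n) x) < e" if "m \<ge> N" "n \<ge> N" for m n
      proof -
        \<comment> \<open>Self-adjointness shifts powers across the product until both exponents
          equal \<open>i + j\<close>, so all these products are values of the decreasing sequence
          \<open>r\<close>.\<close>
        have ip: "p (2 * i) x \<bullet> p (2 * j) x = r (i + j)" for i j
        proof -
          have "p (2 * i) x \<bullet> p (2 * j) x = p i x \<bullet> p (i + 2 * j) x"
            using p_add[of i i x] by (simp add: p_sa p_add flip: mult_2)
          also have "\<dots> = p j (p i x) \<bullet> p (i + j) x"
            unfolding p_sa p_add by (simp add: algebra_simps flip: mult_2)
          finally show ?thesis
            by (simp add: r_def p_add power2_norm_eq_inner add.commute)
        qed
        \<comment> \<open>Counted with multiplicity there are four values of \<open>r\<close>, two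
          of each sign and each within \<open>e^2 / 4\<close> of \<open>l\<close>, so
          \<open>l\<close> cancels.\<close>
        have "norm (p (2 * m) x - p (2 * n) x) ^ 2 = r (m + m) + r (n + n) - 2 * r (m + n)"
          unfolding power2_norm_eq_inner
          by (simp add: inner_diff_left inner_diff_right ip add.commute)
        also have "\<dots> < e^2"
          using N[of "m + m"] N[of "n + n"] N[of "m + n"] that by (simp add: abs_if split: if_splits)
        finally show ?thesis
          using \<open>e > 0\<close> by (simp add: power2_less_imp_less)
      qed
      then show "\<exists>M. \<forall>m\<ge>M. \<forall>n\<ge>M. norm (p (2 * m) x - p (2 * n) x) < e"
        by blast
    qed
  qed
  have "Cauchy t"
  proof (rule CauchyI)
    fix e :: real assume e: "e > 0"
    obtain X where X: "finite X" "X \<subseteq> cball 0 1" "\<And>x. norm x \<le> 1 \<Longrightarrow> \<exists>y\<in>X. norm (c (x - y)) < e / 8"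
      using compact_operator_net[OF K, of "e/8"] e by auto
    have "\<forall>y\<in>X. \<exists>M. \<forall>m\<ge>M. \<forall>n\<ge>M. norm (p (2 * m) y - p (2 * n) y) < e / 4"
      using CauchyD[OF strong, of "e/4"] e by simp
    then obtain M where M: "\<And>y m n. y \<in> X \<Longrightarrow> m \<ge> M y \<Longrightarrow> n \<ge> M y \<Longrightarrow> norm (p (2 * m) y - p (2 * n) y) < e / 4"
      by metis
    define N where "N = Max (insert 0 (M ` X))"
    have N: "M y \<le> N" if "y \<in> X" for y
      using that X(1) by (simp add: N_def)
    have "norm (t m - t n) < e" if mn: "m \<ge> N" "n \<ge> N" for m n
    proof -
      have ball: "norm ((t m - t n) x) \<le> e / 2" if "norm x \<le> 1" for x
      proof -
        obtain y where y: "y \<in> X" "norm (c (x - y)) < e / 8"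
          using X(3) \<open>norm x \<le> 1\<close> by blast
        \<comment> \<open>One factor \<open>c\<close> acts first and makes \<open>x - y\<close>
          small; the remaining odd power of \<open>c\<close> is a contraction.\<close>
        have small: "norm (t k (x - y)) \<le> e / 8" for k
        proof -
          have "t k (x - y) = p (2 * k + 1) (p 1 (x - y))"
            by (simp add: t p_add)
          then have "norm (t k (x - y)) \<le> norm (p 1 (x - y))"
            by (simp add: p_contr)
          then show ?thesis
            using y(2) by (simp add: p_def)
        qed
        have tk: "t k y = p (2 * Suc k) y" for k
          by (simp add: t)
        have "norm (t m y - t n y) < e / 4"
          unfolding tk by (intro M[OF y(1)]) (use mn N[OF y(1)] in auto)
        moreover have eq: "(t m - t n) x = (t m y - t n y) + (t m (x - y) - t n (x - y))"
          by (simp add: blinfun.bilinear_simps)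
        ultimately show ?thesis
          unfolding eq using small[of m] small[of n] norm_triangle_ineq[of "t m y - t n y" "t m (x - y) - t n (x - y)"]
            norm_triangle_ineq4[of "t m (x - y)" "t n (x - y)"] by linarith
      qed
      have "norm (t m - t n) \<le> e / 2"
      proof (rule norm_blinfun_bound)
        fix x
        show "norm ((t m - t n) x) \<le> e / 2 * norm x"
        proof (cases "x = 0")
          case False
          then show ?thesis
            using ball[of "x /\<^sub>R norm x"] by (simp add: blinfun.scaleR_right divide_simps)
        qed simp
      qed (use e in simp)
      then show ?thesis using e by simp
    qed
    then show "\<exists>M. \<forall>m\<ge>M. \<forall>n\<ge>M. norm (t m - t n) < e" by blast
  qed
  then show ?thesis unfolding t_def .
qed

instance chilbert_space \<subseteq> banach ..

lemma blinfun_compose_assoc: "(a o\<^sub>L b) o\<^sub>L c = a o\<^sub>L (b o\<^sub>L c)"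
  by (rule blinfun_eqI) simp

lemma scaleC_zero_left [simp]: "0 *\<^sub>C x = 0"
  using scaleC_of_real[of 0 x] by simp

lemma scaleC_one [simp]: "1 *\<^sub>C x = x"
  using scaleC_of_real[of 1 x] by simp

lemma scaleC_zero_right [simp]: "z *\<^sub>C (0 :: 'a::complex_vector) = 0"
  using scaleC_add_right[of z 0 0] by simp

lemma scaleC_minus_right: "z *\<^sub>C (- x) = - (z *\<^sub>C x)"
  using scaleC_add_right[of z x "- x"] by (simp add: eq_neg_iff_add_eq_0 add.commute)

lemma scaleC_diff_right: "z *\<^sub>C (x - y) = z *\<^sub>C x - z *\<^sub>C y"
  using scaleC_add_right[of z x "- y"] by (simp add: scaleC_minus_right)

lemma inner_scaleC_i_left: "(\<i> *\<^sub>C x) \<bullet> y = - (x \<bullet> (\<i> *\<^sub>C (y :: 'h::chilbert_space)))"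
proof -
  have "(\<i> *\<^sub>C x) \<bullet> y = Re (cnj (cinner y (\<i> *\<^sub>C x)))"
    by (simp add: inner_eq_Re_cinner flip: cinner_commute)
  also have "\<dots> = Re (- \<i> * cinner x y)"
    by (simp add: cinner_scaleC_right cinner_commute[of x y])
  finally show ?thesis
    by (simp add: inner_eq_Re_cinner cinner_scaleC_right)
qed

lemma compose_scaleC_left:
  "(z *\<^sub>C a) o\<^sub>L b = z *\<^sub>C ((a :: 'b::complex_normed_vector \<Rightarrow>\<^sub>L 'c::complex_normed_vector) o\<^sub>L b)"
  by (rule blinfun_eqI) (simp add: scaleC_blinfun.rep_eq)

lemma compose_scaleC_right: "complex_homogeneous a \<Longrightarrow> a o\<^sub>L (z *\<^sub>C b) = z *\<^sub>C (a o\<^sub>L b)"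
  by (rule blinfun_eqI) (simp add: scaleC_blinfun.rep_eq complex_homogeneous_def)

lemmas blinfun_compose_add =
  bounded_bilinear.add_left[OF bounded_bilinear_blinfun_compose]
  bounded_bilinear.add_right[OF bounded_bilinear_blinfun_compose]

lemmas blinfun_compose_diff =
  bounded_bilinear.diff_left[OF bounded_bilinear_blinfun_compose]
  bounded_bilinear.diff_right[OF bounded_bilinear_blinfun_compose]

section \<open>Projections in an operator algebra\<close>

context operator_cstar_algebra
begin

lemma scaleR_closed: "a \<in> A \<Longrightarrow> r *\<^sub>R a \<in> A"
  by (metis scaleC_closed scaleC_of_real)

lemma diff_closed: "a \<in> A \<Longrightarrow> b \<in> A \<Longrightarrow> a - b \<in> A"
  using add_closed[of a "- 1 *\<^sub>R b"] scaleR_closed[of b "-1"] by simp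

lemma is_adjoint_self_iff: "a \<in> A \<Longrightarrow> is_adjoint a a \<longleftrightarrow> self_adjoint a"
  by (simp add: is_adjoint_iff_inner homogeneous self_adjoint_def)

text \<open>Zero is excluded, so that a descending chain in this set cannot end at the zero
  operator.\<close>

definition projections :: "('h \<Rightarrow>\<^sub>L 'h) set"
  where "projections = {p \<in> A. p \<noteq> 0 \<and> p o\<^sub>L p = p \<and> self_adjoint p}"

text \<open>Take adjoints on both sides of the last hypothesis.\<close>

lemma projection_compose_sym:
  assumes "p \<in> projections" "q \<in> projections" "p o\<^sub>L q = q"
  shows "q o\<^sub>L p = q"
proof (rule blinfun_eqI)
  fix x
  have "(q o\<^sub>L p) x \<bullet> y = q x \<bullet> y" for y
  proof -
    have "(q o\<^sub>L p) x \<bullet> y = x \<bullet> (p o\<^sub>L q) y"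
      using assms(1,2) by (simp add: projections_def self_adjoint_def)
    also have "\<dots> = q x \<bullet> y"
      unfolding assms(3) using assms(2) by (simp add: projections_def self_adjoint_def)
    finally show ?thesis .
  qed
  then show "(q o\<^sub>L p) x = q x"
    by (metis vector_eq_rdot)
qed

end

section \<open>Existence of minimal projections\<close>

context compact_operator_cstar_algebra
begin

text \<open>\<open>p\<close> is the limit of the even powers of \<open>c\<close>, that is, the
  spectral projection for the eigenvalues 1 and -1. The last property records that the range of
  \<open>p\<close> lies inside that of \<open>c\<close>, in a form that places \<open>p\<close>
  below any projection \<open>q\<close> fixing \<open>c\<close>.\<close>

lemma support_projection:
  assumes c: "c \<in> A" "self_adjoint c" "norm c = 1"
  obtains p where "p \<in> projections" "(c o\<^sub>L c) o\<^sub>L p = p"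
    "\<And>q. q o\<^sub>L c = c \<Longrightarrow> q o\<^sub>L p = p"
proof -
  define s where "s = c o\<^sub>L c"
  define t where "t n = ((\<lambda>T. s o\<^sub>L T) ^^ n) s" for n
  have t_Suc: "t (Suc n) = s o\<^sub>L t n" for n
    by (simp add: t_def)
  have t0: "t 0 = s" by (simp add: t_def)
  have "Cauchy t"
    using Cauchy_self_adjoint_powers[OF c(2) _ compact[OF c(1)]] c(3)
    by (simp add: t_def[abs_def] s_def)
  then obtain p where p: "t \<longlonglongrightarrow> p"
    by (auto simp: Cauchy_convergent_iff convergent_def)
  have sA: "s \<in> A" unfolding s_def by (intro compose_closed c)
  have tA: "t n \<in> A" for n
    by (induction n) (auto simp: t0 t_Suc sA compose_closed)
  have "p \<in> A"
    using closed_sequentially[OF norm_closed] tA p by blast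
  have ssa: "self_adjoint s"
    using c(2) by (simp add: s_def self_adjoint_def)
  have t_comm: "s o\<^sub>L t n = t n o\<^sub>L s" for n
  proof (induction n)
    case (Suc n)
    show ?case unfolding t_Suc blinfun_compose_assoc by (simp only: Suc)
  qed (simp add: t0)
  have t_add: "t m o\<^sub>L t n = t (Suc (m + n))" for m n
    by (induction m) (auto simp: t0 t_Suc blinfun_compose_assoc)
  have tsa: "self_adjoint (t n)" for n
  proof (induction n)
    case (Suc n)
    show ?case
      unfolding self_adjoint_def
    proof (intro allI)
      fix x y
      have "t (Suc n) x \<bullet> y = x \<bullet> (t n o\<^sub>L s) y"
        using ssa Suc by (simp add: t_Suc self_adjoint_def)
      then show "t (Suc n) x \<bullet> y = x \<bullet> t (Suc n) y"
        by (simp only: t_Suc t_comm)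
    qed
  qed (simp add: t0 ssa)
  have psa: "self_adjoint p"
    unfolding self_adjoint_def
  proof (intro allI)
    fix x y
    have "(\<lambda>n. t n x \<bullet> y) \<longlonglongrightarrow> p x \<bullet> y" "(\<lambda>n. x \<bullet> t n y) \<longlonglongrightarrow> x \<bullet> p y"
      by (intro tendsto_intros p)+
    then show "p x \<bullet> y = x \<bullet> p y"
      using tsa by (auto simp: self_adjoint_def intro: LIMSEQ_unique)
  qed
  have comp_lim: "(\<lambda>n. a o\<^sub>L t n) \<longlonglongrightarrow> (a o\<^sub>L p)" for a
    by (intro bounded_bilinear.tendsto[OF bounded_bilinear_blinfun_compose] tendsto_const p)
  have p_Suc: "(\<lambda>n. t (Suc n)) \<longlonglongrightarrow> p"
    using p by (rule LIMSEQ_Suc)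
  \<comment> \<open>Composing with \<open>s\<close> only shifts the sequence \<open>t\<close> by
    one.\<close>
  have sp: "s o\<^sub>L p = p"
    using LIMSEQ_unique[OF comp_lim[of s]] p_Suc unfolding t_Suc by blast
  have "t n o\<^sub>L p = p" for n
    by (induction n) (auto simp: t0 t_Suc blinfun_compose_assoc sp)
  moreover have "(\<lambda>n. t n o\<^sub>L p) \<longlonglongrightarrow> (p o\<^sub>L p)"
    by (intro bounded_bilinear.tendsto[OF bounded_bilinear_blinfun_compose] tendsto_const p)
  ultimately have pp: "p o\<^sub>L p = p"
    by (simp add: LIMSEQ_const_iff)
  \<comment> \<open>Along the indices \<open>2 ^ n - 1\<close> each term is the square of the
    previous one, because \<open>t m o\<^sub>L t m = t (2 * m + 1)\<close>. The C*-identity then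
    keeps the norm at 1, so the limit cannot vanish.\<close>
  have nt: "norm (t (2 ^ n - 1)) = 1" for n
  proof (induction n)
    case 0
    then show ?case using norm_self_adjoint_square[OF c(2)] c(3) by (simp add: t0 s_def)
  next
    case (Suc n)
    have "t (2 ^ Suc n - 1) = t (2 ^ n - 1) o\<^sub>L t (2 ^ n - 1)"
      unfolding t_add using one_le_power[of "2::nat" n]
      by (intro arg_cong[where f = t]) (simp only: power_Suc, linarith)
    then show ?case
      using norm_self_adjoint_square[OF tsa] Suc by simp
  qed
  have "norm p = 1"
  proof -
    have "strict_mono (\<lambda>n. 2 ^ n - 1 :: nat)"
      by (rule strict_monoI_Suc) (simp add: less_diff_conv Suc_diff_le)
    from LIMSEQ_subseq_LIMSEQ[OF p this] have "(\<lambda>n. norm (t (2 ^ n - 1))) \<longlonglongrightarrow> norm p"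
      by (auto simp: o_def intro: tendsto_norm)
    then show ?thesis using nt by (simp add: LIMSEQ_const_iff)
  qed
  then have "p \<noteq> 0" by auto
  have "q o\<^sub>L p = p" if "q o\<^sub>L c = c" for q
  proof -
    have "q o\<^sub>L s = s"
      using that by (simp add: s_def flip: blinfun_compose_assoc)
    then show ?thesis
      by (metis blinfun_compose_assoc sp)
  qed
  then show thesis
    using that[of p] \<open>p \<noteq> 0\<close> pp psa \<open>p \<in> A\<close> sp by (auto simp: projections_def s_def)
qed

text \<open>Unit vectors chosen in the successive differences of the ranges are orthonormal, hence
  at distance square root of 2 from each other, and \<open>P 0\<close> fixes all of them.
  Compactness of \<open>P 0\<close> forces two of them to be closer than 1.\<close>

lemma no_descending_projections:
  assumes "\<And>n::nat. P n \<in> projections" "\<And>n. P (Suc n) \<noteq> P n" "\<And>n. P n o\<^sub>L P (Suc n) = P (Suc n)"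
  shows False
proof -
  have sa: "P n x \<bullet> y = x \<bullet> P n y" and idem: "P n (P n x) = P n x" for n x y
  proof -
    show "P n x \<bullet> y = x \<bullet> P n y"
      using assms(1)[of n] by (simp add: projections_def self_adjoint_def)
    show "P n (P n x) = P n x"
      using assms(1)[of n] by (metis (mono_tags, lifting) blinfun_apply_blinfun_compose mem_Collect_eq projections_def)
  qed
  have down: "P n (P (Suc n) x) = P (Suc n) x" for n x
    by (metis assms(3) blinfun_apply_blinfun_compose)
  have down': "P (Suc n) (P n x) = P (Suc n) x" for n x
    by (metis assms(1,3) blinfun_apply_blinfun_compose projection_compose_sym)
  have le: "P n (P (n + k) x) = P (n + k) x" for n k x
  proof (induction k arbitrary: n x)
    case (Suc k)
    then show ?case by (metis add_Suc_right add_Suc_shift down)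
  qed (simp add: idem)
  have "\<exists>x. norm x = 1 \<and> P n x = x \<and> P (Suc n) x = 0" for n
  proof -
    obtain y where y: "P n y \<noteq> P (Suc n) y"
      using assms(2)[of n] by (metis blinfun_eqI)
    define x where "x = P n y - P (Suc n) y"
    have "P n x = x" "P (Suc n) x = 0" "x \<noteq> 0"
      using y by (simp_all add: x_def blinfun.diff_right down down' idem)
    then show ?thesis
      by (intro exI[of _ "x /\<^sub>R norm x"]) (simp add: blinfun.scaleR_right)
  qed
  then obtain x where x: "\<And>n. norm (x n) = 1" "\<And>n. P n (x n) = x n" "\<And>n. P (Suc n) (x n) = 0"
    by metis
  have orth: "x n \<bullet> x m = 0" if "n < m" for n m
  proof -
    have "P (Suc n) (x m) = x m"
      by (metis less_iff_Suc_add that x(2) le add_Suc)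
    then show ?thesis
      by (metis sa inner_zero_left x(3))
  qed
  obtain X where X: "finite X" "\<And>x. norm x \<le> 1 \<Longrightarrow> \<exists>y\<in>X. norm (P 0 (x - y)) < 1/2"
  proof -
    have "compact_operator (P 0)"
      using compact assms(1)[of 0] by (simp add: projections_def)
    then show thesis
      by (rule compact_operator_net[of _ "1/2"]) (use that in auto)
  qed
  then have "\<forall>n. \<exists>y\<in>X. norm (P 0 (x n - y)) < 1/2"
    by (simp add: x(1))
  then obtain f where f: "\<And>n. f n \<in> X" "\<And>n. norm (P 0 (x n - f n)) < 1/2"
    by metis
  have "\<not> inj f"
    using X(1) f(1) by (meson finite_subset image_subset_iff infinite_UNIV_nat finite_imageD)
  then obtain n m where nm: "n < m" "f n = f m"
    unfolding inj_def by (metis linorder_neqE_nat)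
  have fix0: "P 0 (x k) = x k" for k
    by (metis add_0 le x(2))
  have "norm (x n - x m) \<le> norm (P 0 (x n - f n)) + norm (P 0 (x m - f m))"
    using norm_triangle_ineq4[of "P 0 (x n - f n)" "P 0 (x m - f m)"] nm(2) fix0
    by (simp add: blinfun.diff_right)
  also have "\<dots> < 1"
    using f(2)[of n] f(2)[of m] by simp
  finally have "norm (x n - x m) ^ 2 < 1"
    by (simp add: power_less_one_iff abs_square_less_1)
  moreover have "norm (x n - x m) ^ 2 = 2"
    using orth[OF nm(1)] x(1)[of n] x(1)[of m]
    unfolding power2_norm_eq_inner by (simp add: inner_diff_left inner_diff_right inner_commute norm_eq_1)
  ultimately show False by simp
qed

text \<open>Since chains stop, there is a \<open>q\<close> below \<open>p\<close> with no other
  projection below it. The work is to pass from this order minimality to the corner of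
  \<open>A\<close> at \<open>q\<close> being one-dimensional: squares of self-adjoint corner
  elements are scalar first, then self-adjoint elements, then all elements.\<close>

lemma exists_minimal_projection_below:
  assumes p: "p \<in> projections"
  obtains e where "minimal_projection A e" "p o\<^sub>L e = e"
proof -
  define below where "below q r \<longleftrightarrow> r \<in> projections \<and> q o\<^sub>L r = r" for q r
  have "\<exists>q. below p q \<and> (\<forall>r. below q r \<longrightarrow> r = q)"
  proof (rule ccontr)
    assume "\<not> ?thesis"
    then have step: "\<exists>r. below p r \<and> below q r \<and> r \<noteq> q" if "below p q" for q
      using that unfolding below_def by (metis blinfun_compose_assoc)
    have "below p p"
      using p by (simp add: below_def projections_def)
    then have "\<exists>P. \<forall>n. below p (P n) \<and> (below (P n) (P (Suc n)) \<and> P (Suc n) \<noteq> P n)"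
      using step by (intro dependent_nat_choice[where P = "\<lambda>_. below p"]) blast+
    then obtain P where "\<And>n. below p (P n)" "\<And>n. below (P n) (P (Suc n))" "\<And>n. P (Suc n) \<noteq> P n"
      by blast
    then show False
      using no_descending_projections[of P] unfolding below_def by blast
  qed
  then obtain q where q: "q \<in> projections" "p o\<^sub>L q = q"
    and min: "\<And>r. r \<in> projections \<Longrightarrow> q o\<^sub>L r = r \<Longrightarrow> r = q"
    unfolding below_def by blast
  have qA: "q \<in> A" "q \<noteq> 0" "q o\<^sub>L q = q" "self_adjoint q"
    using q(1) by (auto simp: projections_def)
  have square: "c o\<^sub>L c = norm c ^ 2 *\<^sub>R q"
    if c: "c \<in> A" "self_adjoint c" "q o\<^sub>L c = c" "c o\<^sub>L q = c" for c
  proof (cases "c = 0")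
    case False
    define d where "d = c /\<^sub>R norm c"
    have d: "d \<in> A" "self_adjoint d" "norm d = 1" "q o\<^sub>L d = d"
      using c False by (auto simp: d_def scaleR_closed self_adjoint_def blinfun.scaleR_left
          intro!: blinfun_eqI) (metis blinfun_apply_blinfun_compose blinfun.scaleR_right)
    obtain r where r: "r \<in> projections" "(d o\<^sub>L d) o\<^sub>L r = r" "q o\<^sub>L r = r"
      using support_projection[OF d(1-3)] d(4) by metis
    have "r = q" using min r by blast
    then have "d o\<^sub>L d = q"
      using r(2) c(4) by (metis blinfun_compose_assoc bounded_bilinear.scaleR_left
          bounded_bilinear_blinfun_compose d_def)
    then have "(norm c ^ 2) *\<^sub>R (d o\<^sub>L d) = norm c ^ 2 *\<^sub>R q" by simp
    moreover have "(norm c ^ 2) *\<^sub>R (d o\<^sub>L d) = c o\<^sub>L c"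
    proof (rule blinfun_eqI)
      fix x
      have "(norm c)\<^sup>2 * (inverse (norm c) * inverse (norm c)) = 1"
        using False by (simp add: power2_eq_square field_simps)
      then show "((norm c)\<^sup>2 *\<^sub>R (d o\<^sub>L d)) x = (c o\<^sub>L c) x"
        by (simp add: d_def blinfun.bilinear_simps)
    qed
    ultimately show ?thesis by simp
  qed simp
  \<comment> \<open>Apply \<open>square\<close> to \<open>c\<close> and to \<open>c + q\<close>: in
    the expanded square of \<open>c + q\<close>, the only term not yet known to be a multiple of
    \<open>q\<close> is \<open>2 *\<^sub>R c\<close>.\<close>
  have sa_scalar: "\<exists>r. c = r *\<^sub>R q"
    if c: "c \<in> A" "self_adjoint c" "q o\<^sub>L c = c" "c o\<^sub>L q = c" for c
  proof -
    have "(c + q) o\<^sub>L (c + q) = norm (c + q) ^ 2 *\<^sub>R q"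
      using c qA by (intro square)
        (auto simp: add_closed self_adjoint_def inner_add_left inner_add_right blinfun.add_left blinfun_compose_add)
    moreover have "(c + q) o\<^sub>L (c + q) = norm c ^ 2 *\<^sub>R q + 2 *\<^sub>R c + q"
      using c qA square[OF c] by (simp add: scaleR_2 blinfun_compose_add)
    ultimately have "2 *\<^sub>R c = (norm (c + q) ^ 2 - norm c ^ 2 - 1) *\<^sub>R q"
      by (simp add: algebra_simps)
    then have "c = ((norm (c + q) ^ 2 - norm c ^ 2 - 1) / 2) *\<^sub>R q"
      by (metis (no_types, lifting) divide_inverse_commute inverse_eq_divide mult.commute scaleR_half_double scaleR_scaleR scaleR_2 times_divide_eq_left mult_1)
    then show ?thesis by blast
  qed
  \<comment> \<open>A corner element \<open>b\<close> with adjoint \<open>b'\<close> is split into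
    real and imaginary parts: \<open>b + b'\<close> and \<open>\<i> *\<^sub>C (b - b')\<close> are
    self-adjoint and lie in the corner, so \<open>sa_scalar\<close> applies to both.\<close>
  have scalar: "\<exists>z. q o\<^sub>L a o\<^sub>L q = z *\<^sub>C q" if "a \<in> A" for a
  proof -
    define b where "b = q o\<^sub>L a o\<^sub>L q"
    have bA: "b \<in> A" unfolding b_def by (intro compose_closed qA that)
    obtain b' where b': "b' \<in> A" "is_adjoint b' b"
      using adjoint_closed[OF bA] by blast
    have adj: "b' x \<bullet> y = x \<bullet> b y" "b x \<bullet> y = x \<bullet> b' y" for x y
      using b'(2) is_adjointD is_adjoint_commute by blast+
    have qb: "q o\<^sub>L b = b" "b o\<^sub>L q = b"
      by (simp_all add: b_def blinfun_compose_assoc qA) (simp add: qA flip: blinfun_compose_assoc)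
    have qb': "q o\<^sub>L b' = b'" "b' o\<^sub>L q = b'"
    proof -
      have qq: "q x \<bullet> y = x \<bullet> q y" for x y
        using qA(4) by (simp add: self_adjoint_def)
      show "q o\<^sub>L b' = b'"
      proof (rule blinfun_eqI)
        fix x
        have "(q o\<^sub>L b') x \<bullet> y = b' x \<bullet> y" for y
          using adj(1)[of x "q y"] adj(1)[of x y] qb by (metis qq blinfun_apply_blinfun_compose)
        then show "(q o\<^sub>L b') x = b' x" by (metis vector_eq_rdot)
      qed
      show "b' o\<^sub>L q = b'"
      proof (rule blinfun_eqI)
        fix x
        have "(b' o\<^sub>L q) x \<bullet> y = b' x \<bullet> y" for y
          using adj(1)[of "q x" "y"] adj(1)[of x y] qb by (metis qq blinfun_apply_blinfun_compose)
        then show "(b' o\<^sub>L q) x = b' x" by (metis vector_eq_rdot)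
      qed
    qed
    have hom: "b (\<i> *\<^sub>C x) = \<i> *\<^sub>C b x" "b' (\<i> *\<^sub>C x) = \<i> *\<^sub>C b' x" for x
      using homogeneous bA b'(1) by (auto simp: complex_homogeneous_def)
    have "\<exists>r. b + b' = r *\<^sub>R q"
      using bA b'(1) qb qb' by (intro sa_scalar)
        (auto simp: add_closed self_adjoint_def adj inner_add_left inner_add_right blinfun.add_left blinfun_compose_add)
    then obtain r where r: "b + b' = r *\<^sub>R q" by blast
    have "\<exists>r. \<i> *\<^sub>C (b - b') = r *\<^sub>R q"
    proof (rule sa_scalar)
      show "\<i> *\<^sub>C (b - b') \<in> A" using bA b'(1) by (intro scaleC_closed diff_closed)
      show "self_adjoint (\<i> *\<^sub>C (b - b'))"
        by (auto simp: self_adjoint_def scaleC_blinfun.rep_eq blinfun.diff_left inner_scaleC_i_left hom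
            inner_diff_left inner_diff_right adj scaleC_diff_right)
      show "q o\<^sub>L \<i> *\<^sub>C (b - b') = \<i> *\<^sub>C (b - b')"
        using qb qb' homogeneous[OF qA(1)] by (simp add: compose_scaleC_right blinfun_compose_diff)
      show "\<i> *\<^sub>C (b - b') o\<^sub>L q = \<i> *\<^sub>C (b - b')"
        using qb qb' by (simp add: compose_scaleC_left blinfun_compose_diff)
    qed
    then obtain r' where r': "\<i> *\<^sub>C (b - b') = r' *\<^sub>R q" by blast
    have "2 *\<^sub>R b = (b + b') + (- \<i>) *\<^sub>C (\<i> *\<^sub>C (b - b'))"
      by (simp add: scaleC_scaleC scaleR_2)
    also have "\<dots> = (of_real r + (- \<i>) * of_real r') *\<^sub>C q"
      unfolding r r' scaleC_add_left by (simp only: scaleC_of_real flip: scaleC_scaleC)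
    finally have eq: "2 *\<^sub>R b = (of_real r + (- \<i>) * of_real r') *\<^sub>C q" .
    have "b = (1/2) *\<^sub>R (2 *\<^sub>R b)" by simp
    also have "\<dots> = (of_real (1/2) * (of_real r + (- \<i>) * of_real r')) *\<^sub>C q"
      unfolding eq by (simp only: scaleC_of_real flip: scaleC_scaleC)
    finally have "b = (of_real (1/2) * (of_real r + (- \<i>) * of_real r')) *\<^sub>C q" .
    then show ?thesis unfolding b_def by blast
  qed
  have "minimal_projection A q"
    unfolding minimal_projection_def
  proof (intro conjI qA)
    show "is_adjoint q q" using qA is_adjoint_self_iff by blast
    show "{q o\<^sub>L a o\<^sub>L q |a. a \<in> A} = {z *\<^sub>C q |z. True}"
    proof
      show "{q o\<^sub>L a o\<^sub>L q |a. a \<in> A} \<subseteq> {z *\<^sub>C q |z. True}" using scalar by blast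
      have "z *\<^sub>C q = q o\<^sub>L (z *\<^sub>C q) o\<^sub>L q" for z
        using qA homogeneous by (simp add: compose_scaleC_left compose_scaleC_right)
      then show "{z *\<^sub>C q |z. True} \<subseteq> {q o\<^sub>L a o\<^sub>L q |a. a \<in> A}"
        using qA(1) scaleC_closed by blast
    qed
  qed
  then show thesis using that q(2) by blast
qed

end

section \<open>Hilbert modules and orthonormal systems\<close>

lemma cinner_add_left: "cinner (x + x') y = cinner x y + cinner x' y"
  unfolding cinner_commute[of _ y] by (simp add: cinner_add_right)

lemma cinner_scaleC_left: "cinner (z *\<^sub>C x) y = cnj z * cinner x y"
  unfolding cinner_commute[of _ y] by (simp add: cinner_scaleC_right)

lemma is_adjoint_add: "is_adjoint S T \<Longrightarrow> is_adjoint S' T' \<Longrightarrow> is_adjoint (S + S') (T + T')"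
  by (simp add: is_adjoint_def blinfun.add_left cinner_add_right cinner_add_left)

lemma is_adjoint_scaleR: "is_adjoint S T \<Longrightarrow> is_adjoint (r *\<^sub>R S) (r *\<^sub>R T)"
  by (simp add: is_adjoint_def scaleC_blinfun.rep_eq cinner_scaleC_left cinner_scaleC_right
      flip: scaleC_of_real)

lemma is_adjoint_compose: "is_adjoint S T \<Longrightarrow> is_adjoint S' T' \<Longrightarrow> is_adjoint (S o\<^sub>L S') (T' o\<^sub>L T)"
  by (simp add: is_adjoint_def)

section \<open>The operator-valued product and the Cauchy-Schwarz inequality\<close>

context hilbert_module
begin

lemma ip_add_right: "ip u (v + w) = ip u v + ip u w"
  using ip_linear[of u 1 v w] by simp

lemma ip_zero_right: "ip u 0 = 0"
  using ip_add_right[of u 0 0] by simp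

lemma ip_scaleC_right: "ip u (z *\<^sub>C v) = z *\<^sub>C ip u v"
  using ip_linear[of u z v 0] by (simp add: ip_zero_right)

lemma ip_scaleR_right: "ip u (r *\<^sub>R v) = r *\<^sub>R ip u v"
  by (metis ip_scaleC_right scaleC_of_real)

text \<open>Adjoints are unique. Through this rule the laws for the second argument of the product
  transfer to the first.\<close>

lemma ip_eqI: "is_adjoint b (ip v u) \<Longrightarrow> ip u v = b"
  using ip_adjoint is_adjoint_unique by blast

lemma ip_add_left: "ip (u + v) w = ip u w + ip v w"
  by (rule ip_eqI) (simp add: ip_add_right is_adjoint_add ip_adjoint)

lemma ip_scaleR_left: "ip (r *\<^sub>R u) v = r *\<^sub>R ip u v"
  by (rule ip_eqI) (simp add: ip_scaleR_right is_adjoint_scaleR ip_adjoint)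

lemma ip_act_left:
  assumes "a \<in> A" "is_adjoint b a"
  shows "ip (act u a) v = b o\<^sub>L ip u v"
  by (rule ip_eqI) (simp add: ip_act is_adjoint_compose ip_adjoint assms)

lemma norm_ip_self: "norm (ip u u) = norm u ^ 2"
  by (simp add: norm_eq)

lemma inner_ip: "ip u v x \<bullet> y = x \<bullet> ip v u y"
  using ip_adjoint by (rule is_adjointD)

lemma ip_self_nonneg: "0 \<le> x \<bullet> ip u u x"
  using ip_positive by (rule positive_operatorD)

lemma ip_self_le: "x \<bullet> ip u u x \<le> norm u ^ 2 * norm x ^ 2"
proof -
  have "x \<bullet> ip u u x \<le> norm x * norm (ip u u x)"
    by (rule norm_cauchy_schwarz)
  also have "\<dots> \<le> norm x * (norm (ip u u) * norm x)"
    by (intro mult_left_mono norm_blinfun) simp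
  finally show ?thesis
    by (simp add: norm_ip_self power2_eq_square mult_ac)
qed

text \<open>Positivity of \<open>ip w w\<close> for
  \<open>w = t *\<^sub>R act u (ip u v) - v\<close>, where \<open>t\<close> minimises the resulting
  quadratic bound. Keeping the vector \<open>x\<close> gives an inequality between operators, which
  is stronger than one between norms and is needed in this form below.\<close>

lemma Cauchy_Schwarz_ip: "norm (ip u v x) ^ 2 \<le> norm u ^ 2 * (x \<bullet> ip v v x)"
proof (cases "u = 0")
  case True
  then show ?thesis using ip_scaleR_left[of 0 u v] by simp
next
  case False
  define c where "c = ip u v"
  define t where "t = 1 / norm u ^ 2"
  have cA: "c \<in> A" by (simp add: c_def ip_in)
  define w where "w = t *\<^sub>R act u c + (- 1) *\<^sub>R v"
  have adj: "is_adjoint (ip v u) c"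
    unfolding c_def by (rule ip_adjoint)
  have eq: "ip w w = t^2 *\<^sub>R (ip v u o\<^sub>L ip u u o\<^sub>L c) - (2 * t) *\<^sub>R (ip v u o\<^sub>L c) + ip v v"
    unfolding w_def ip_add_left ip_add_right ip_scaleR_left ip_scaleR_right
    by (simp add: ip_act[OF cA] ip_act_left[OF cA adj] power2_eq_square blinfun_compose_assoc
        c_def[symmetric] algebra_simps scaleR_2[symmetric])
  have "0 \<le> x \<bullet> ip w w x"
    by (rule ip_self_nonneg)
  also have "\<dots> = t^2 * (c x \<bullet> ip u u (c x)) - 2 * t * (c x \<bullet> c x) + x \<bullet> ip v v x"
    unfolding eq by (simp add: blinfun.bilinear_simps inner_add_right inner_diff_right c_def inner_ip)
  also have "\<dots> \<le> t^2 * (norm u ^ 2 * norm (c x) ^ 2) - 2 * t * (c x \<bullet> c x) + x \<bullet> ip v v x"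
    by (simp add: mult_left_mono ip_self_le)
  also have "\<dots> = x \<bullet> ip v v x - norm (c x) ^ 2 / norm u ^ 2"
    using False by (simp add: t_def power2_norm_eq_inner[of "c x", symmetric] field_simps power2_eq_square)
  finally show ?thesis
    using False by (simp add: c_def field_simps)
qed

lemma norm_ip_le: "norm (ip u v) \<le> norm u * norm v"
proof (rule norm_blinfun_bound)
  fix x
  have "norm (ip u v x) ^ 2 \<le> norm u ^ 2 * (norm v ^ 2 * norm x ^ 2)"
    by (rule order_trans[OF Cauchy_Schwarz_ip]) (simp add: mult_left_mono ip_self_le)
  then have "norm (ip u v x) ^ 2 \<le> (norm u * norm v * norm x) ^ 2"
    by (simp add: power_mult_distrib mult.assoc)
  then show "norm (ip u v x) \<le> norm u * norm v * norm x"
    by (rule power2_le_imp_le) simp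
qed simp

sublocale ip: bounded_bilinear ip
proof
  show "\<exists>K. \<forall>u v. norm (ip u v) \<le> norm u * norm v * K"
    by (intro exI[of _ 1]) (simp add: norm_ip_le)
qed (simp_all add: ip_add_left ip_add_right ip_scaleR_left ip_scaleR_right)

text \<open>A bound on the quadratic form of the positive operator \<open>ip u u\<close> bounds its
  norm: Cauchy-Schwarz with \<open>v = u\<close> gives \<open>norm u * K\<close> as a bound, and one
  factor \<open>norm u\<close> cancels.\<close>

lemma norm_le_of_ip_self_le:
  assumes "\<And>x. x \<bullet> ip u u x \<le> K ^ 2 * norm x ^ 2" "0 \<le> K"
  shows "norm u \<le> K"
proof -
  have "norm (ip u u) \<le> norm u * K"
  proof (rule norm_blinfun_bound)
    fix x
    have "norm (ip u u x) ^ 2 \<le> norm u ^ 2 * (K ^ 2 * norm x ^ 2)"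
      by (rule order_trans[OF Cauchy_Schwarz_ip]) (simp add: mult_left_mono assms)
    then have "norm (ip u u x) ^ 2 \<le> (norm u * K * norm x) ^ 2"
      by (simp add: power_mult_distrib mult.assoc)
    then show "norm (ip u u x) \<le> norm u * K * norm x"
      by (rule power2_le_imp_le) (simp add: assms)
  qed (simp add: assms)
  then have "norm u * norm u \<le> norm u * K"
    by (simp add: norm_ip_self power2_eq_square)
  then show ?thesis
    using assms(2) by (cases "u = 0") auto
qed

lemma act_scaleR_left: "a \<in> A \<Longrightarrow> act (r *\<^sub>R u) a = r *\<^sub>R act u a"
  by (metis act_scaleC_left scaleC_of_real)

lemma act_zero_left: "a \<in> A \<Longrightarrow> act 0 a = 0"
  using act_scaleR_left[of a 0 0] by simp

lemma act_zero_right [simp]: "act u 0 = 0"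
  using act_scaleC_right[OF zero_closed, of u 0] by simp

lemma act_diff_left: "a \<in> A \<Longrightarrow> act (u - v) a = act u a - act v a"
  using act_add_left[of a u "- 1 *\<^sub>R v"] act_scaleR_left[of a "-1" v] by simp

lemma act_scaleR_right: "a \<in> A \<Longrightarrow> act u (r *\<^sub>R a) = r *\<^sub>R act u a"
  by (metis act_scaleC_right scaleC_of_real)

lemma norm_act_le:
  assumes a: "a \<in> A"
  shows "norm (act u a) \<le> norm u * norm a"
proof (rule norm_le_of_ip_self_le)
  obtain b where b: "b \<in> A" "is_adjoint b a"
    using adjoint_closed[OF a] by blast
  fix x
  have "x \<bullet> ip (act u a) (act u a) x = a x \<bullet> ip u u (a x)"
    using is_adjointD[OF is_adjoint_commute[OF b(2)]]
    by (simp add: ip_act a ip_act_left[OF a b(2)])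
  also have "\<dots> \<le> norm u ^ 2 * norm (a x) ^ 2"
    by (rule ip_self_le)
  also have "\<dots> \<le> norm u ^ 2 * (norm a * norm x) ^ 2"
    by (intro mult_left_mono power_mono norm_blinfun) auto
  finally show "x \<bullet> ip (act u a) (act u a) x \<le> (norm u * norm a) ^ 2 * norm x ^ 2"
    by (simp add: power_mult_distrib mult.assoc)
qed simp

lemma bounded_linear_act_left: "a \<in> A \<Longrightarrow> bounded_linear (\<lambda>u. act u a)"
  by (rule bounded_linear_intro[where K = "norm a"]) (auto simp: act_add_left act_scaleR_left norm_act_le)

lemma bounded_linear_elementary: "bounded_linear (\<lambda>x. act v (ip u x))"
proof (rule bounded_linear_intro[where K = "norm v * norm u"])
  show "norm (act v (ip u x)) \<le> norm x * (norm v * norm u)" for x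
    using order_trans[OF norm_act_le[OF ip_in] mult_left_mono[OF norm_ip_le], of v u x]
    by (simp add: mult_ac)
qed (auto simp: ip_in ip.add_right ip.scaleR_right act_add_right act_scaleR_right)

lemma norm_ip_commute: "norm (ip u v) = norm (ip v u)"
  using ip_adjoint norm_is_adjoint by blast

lemma ip_eq_zero_commute: "ip u v = 0 \<longleftrightarrow> ip v u = 0"
  by (metis norm_ip_commute norm_eq_zero)

section \<open>Submodules and orthogonal complements\<close>

lemma submodule_subspace: "submodule A act W \<Longrightarrow> subspace W"
  unfolding submodule_def subspace_def by (metis scaleC_of_real)

lemma submodule_diff: "submodule A act W \<Longrightarrow> u \<in> W \<Longrightarrow> v \<in> W \<Longrightarrow> u - v \<in> W"
  using submodule_subspace subspace_diff by blast

lemma submodule_scaleR: "submodule A act W \<Longrightarrow> u \<in> W \<Longrightarrow> r *\<^sub>R u \<in> W"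
  using submodule_subspace subspace_scale by blast

lemma submodule_sum: "submodule A act W \<Longrightarrow> (\<And>i. i \<in> I \<Longrightarrow> f i \<in> W) \<Longrightarrow> sum f I \<in> W"
  using submodule_subspace subspace_sum by blast

lemma submodule_hull: "submodule A act (submodule A act hull S)"
  by (rule hull_in) (auto simp: submodule_def)

lemma bounded_linear_scaleC: "bounded_linear (\<lambda>u::'u. z *\<^sub>C u)"
  by (rule bounded_linear_intro[where K = "norm z"])
    (auto simp: scaleC_add_right norm_scaleC mult.commute scaleC_scaleC simp flip: scaleC_of_real)

lemma submodule_closure:
  assumes "submodule A act W"
  shows "submodule A act (closure W)"
proof -
  have inv: "f u \<in> closure W" if "u \<in> closure W" "bounded_linear f" "f ` W \<subseteq> W" for f u
    using closure_bounded_linear_image_subset[OF that(2), of W] closure_mono[OF that(3)] that(1) by blast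
  show ?thesis
    unfolding submodule_def
  proof (intro conjI ballI allI)
    show "0 \<in> closure W"
      using assms closure_subset unfolding submodule_def by blast
    show "u + v \<in> closure W" if "u \<in> closure W" "v \<in> closure W" for u v
    proof -
      obtain x where "\<forall>n. x n \<in> W" "x \<longlonglongrightarrow> u"
        using \<open>u \<in> closure W\<close> unfolding closure_sequential by blast
      moreover obtain y where "\<forall>n. y n \<in> W" "y \<longlonglongrightarrow> v"
        using \<open>v \<in> closure W\<close> unfolding closure_sequential by blast
      ultimately have "\<forall>n. x n + y n \<in> W" "(\<lambda>n. x n + y n) \<longlonglongrightarrow> u + v"
        using assms by (auto simp: submodule_def intro: tendsto_add)
      then show ?thesis
        unfolding closure_sequential by (intro exI[of _ "\<lambda>n. x n + y n"] conjI)
    qed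
    show "z *\<^sub>C u \<in> closure W" if "u \<in> closure W" for u z
      using assms by (intro inv[OF that bounded_linear_scaleC]) (auto simp: submodule_def)
    show "act u a \<in> closure W" if "u \<in> closure W" "a \<in> A" for u a
      using assms that(2) by (intro inv[OF that(1) bounded_linear_act_left]) (auto simp: submodule_def)
  qed
qed

lemma submodule_orthocomplement: "submodule A act (orthocomplement ip S)"
proof -
  have "ip (z *\<^sub>C u) v = 0" "a \<in> A \<Longrightarrow> ip (act u a) v = 0" if "ip u v = 0" for z u v a
    using that by (simp_all add: ip_eq_zero_commute[of _ v] ip_scaleC_right ip_act)
  then show ?thesis
    by (auto simp: submodule_def orthocomplement_def ip.add_left ip.zero_left)
qed

lemma closed_orthocomplement: "closed (orthocomplement ip S)"
proof -
  have "orthocomplement ip S = (\<Inter>s\<in>S. {v. ip v s = 0})"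
    by (auto simp: orthocomplement_def)
  moreover have "closed {v. ip v s = 0}" for s
    by (intro closed_Collect_eq continuous_intros ip.continuous_on)
  ultimately show ?thesis by auto
qed

text \<open>The elements orthogonal to \<open>v\<close> form a closed submodule, so once it contains
  \<open>S\<close> it contains the closed hull.\<close>

lemma orthocomplement_hull:
  assumes "\<And>s. s \<in> S \<Longrightarrow> ip v s = 0" "w \<in> closure (submodule A act hull S)"
  shows "ip v w = 0"
proof -
  have "S \<subseteq> orthocomplement ip {v}"
    using assms(1) by (auto simp: orthocomplement_def ip_eq_zero_commute[of _ v])
  then have "submodule A act hull S \<subseteq> orthocomplement ip {v}"
    by (intro hull_minimal submodule_orthocomplement)
  then have "closure (submodule A act hull S) \<subseteq> orthocomplement ip {v}"
    by (intro closure_minimal closed_orthocomplement)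
  then show ?thesis
    using assms(2) ip_eq_zero_commute by (auto simp: orthocomplement_def)
qed

section \<open>Vectors whose square is a minimal projection\<close>

lemma minimal_projectionD:
  assumes "minimal_projection A e"
  shows "e \<in> A" "e o\<^sub>L e = e" "is_adjoint e e" "e \<noteq> 0"
    "a \<in> A \<Longrightarrow> \<exists>z. e o\<^sub>L a o\<^sub>L e = z *\<^sub>C e"
  using assms unfolding minimal_projection_def by auto

lemma norm_minimal_projection:
  assumes "minimal_projection A e"
  shows "norm e = 1"
proof -
  have "self_adjoint e"
    using minimal_projectionD(3)[OF assms] is_adjointD by (auto simp: self_adjoint_def)
  from norm_self_adjoint_square[OF this] show ?thesis
    using minimal_projectionD(2,4)[OF assms] by (simp add: power2_eq_square)
qed

text \<open>Because \<open>e\<close> fixes \<open>u\<close>, \<open>ip u u\<close> lies in the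
  corner at \<open>e\<close> and is a scalar multiple \<open>z\<close> of \<open>e\<close>.
  Positivity and definiteness make \<open>z\<close> a positive real, and \<open>r\<close> is the
  inverse of its square root.\<close>

lemma normalize_minimal:
  assumes e: "minimal_projection A e" and u: "act u e = u" "u \<noteq> 0"
  obtains r :: real where "r > 0" "ip (r *\<^sub>R u) (r *\<^sub>R u) = e"
proof -
  note eD = minimal_projectionD[OF e]
  have "ip u u = e o\<^sub>L ip u u o\<^sub>L e"
    using ip_act[OF eD(1), of u u] ip_act_left[OF eD(1,3), of u u]
    by (metis u(1) blinfun_compose_assoc)
  then obtain z where z: "ip u u = z *\<^sub>C e"
    using eD(5)[OF ip_in, of u u] by metis
  obtain x where x: "e x \<noteq> 0"
    using eD(4) by (metis blinfun_eqI zero_blinfun.rep_eq)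
  have ee: "e (e x) = e x"
    using eD(2) by (metis blinfun_apply_blinfun_compose)
  have zp: "cinner (e x) (ip u u (e x)) = z * cinner (e x) (e x)"
    by (simp add: z scaleC_blinfun.rep_eq ee cinner_scaleC_right)
  have nn: "cinner (e x) (e x) = of_real ((norm (e x))\<^sup>2)"
    by (rule complex_eqI) (use cinner_commute[of "e x" "e x"] in
      \<open>simp_all add: power2_norm_eq_inner inner_eq_Re_cinner complex_eq_iff\<close>)
  have "z * of_real ((norm (e x))\<^sup>2) \<in> \<real>\<^sub>\<ge>\<^sub>0"
    using ip_positive[of u] zp nn unfolding positive_operator_def by metis
  then have "z * of_real ((norm (e x))\<^sup>2) / of_real ((norm (e x))\<^sup>2) \<in> \<real>\<^sub>\<ge>\<^sub>0"
    by (intro nonneg_Reals_divide_I) auto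
  then have "z \<in> \<real>\<^sub>\<ge>\<^sub>0"
    using x by simp
  then obtain t where t: "z = of_real t" "t \<ge> 0"
    by (auto elim: nonneg_Reals_cases)
  have "t \<noteq> 0"
    using u(2) ip_definite[of u] z t(1) by auto
  then have tpos: "t > 0" using t(2) by simp
  have "(1 / sqrt t) * ((1 / sqrt t) * t) = 1"
    using tpos by simp
  then have "ip ((1 / sqrt t) *\<^sub>R u) ((1 / sqrt t) *\<^sub>R u) = e"
    unfolding ip.scaleR_left ip.scaleR_right z t(1) scaleC_of_real scaleR_scaleR by simp
  then show thesis
    using that[of "1 / sqrt t"] tpos by simp
qed

text \<open>With \<open>e = ip u u\<close> idempotent, the four terms in the square of
  \<open>act u e - u\<close> cancel.\<close>

lemma act_ip_self:
  assumes "minimal_projection A (ip u u)"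
  shows "act u (ip u u) = u"
proof -
  define e where "e = ip u u"
  note eD = minimal_projectionD[OF assms, folded e_def]
  have "ip (act u e - u) (act u e - u) = 0"
    by (simp add: ip.diff_left ip.diff_right ip_act[OF eD(1)] ip_act_left[OF eD(1,3)] e_def[symmetric] eD(2))
  then show ?thesis
    using ip_definite[of "act u e - u"] by (simp add: e_def)
qed

lemma ip_self_compose_ip:
  assumes "minimal_projection A (ip u u)"
  shows "ip u u o\<^sub>L ip u v = ip u v"
  using ip_act_left[OF ip_in ip_adjoint, of u u u v] act_ip_self[OF assms] by simp

lemma norm_minimal: "minimal_projection A (ip u u) \<Longrightarrow> norm u = 1"
  using norm_minimal_projection[of "ip u u"] by (simp add: norm_eq)

end

text \<open>Two finite sets containing \<open>F\<close> differ only in what they have outside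
  \<open>F\<close>, so small tails make the net of finite partial sums Cauchy.\<close>

lemma summable_on_CauchyI:
  fixes f :: "'a \<Rightarrow> 'b::banach"
  assumes "\<And>e. e > 0 \<Longrightarrow> \<exists>F. finite F \<and> F \<subseteq> B \<and> (\<forall>G. finite G \<and> G \<subseteq> B - F \<longrightarrow> norm (sum f G) \<le> e)"
  shows "f summable_on B"
proof -
  have "\<exists>P. eventually P (finite_subsets_at_top B) \<and>
      (\<forall>F1 F2. P F1 \<and> P F2 \<longrightarrow> dist (sum f F1) (sum f F2) < e)" if "e > 0" for e
  proof -
    obtain F where F: "finite F" "F \<subseteq> B"
      and small: "\<And>G. finite G \<Longrightarrow> G \<subseteq> B - F \<Longrightarrow> norm (sum f G) \<le> e / 3"
      using assms[of "e / 3"] \<open>e > 0\<close> by auto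
    define P where "P S \<longleftrightarrow> finite S \<and> F \<subseteq> S \<and> S \<subseteq> B" for S
    have "eventually P (finite_subsets_at_top B)"
      using F unfolding P_def eventually_finite_subsets_at_top by blast
    moreover have "dist (sum f F1) (sum f F2) < e" if "P F1 \<and> P F2" for F1 F2
    proof -
      have "sum f S = sum f F + sum f (S - F)" if "P S" for S
        using that by (metis P_def add.commute sum.subset_diff)
      moreover have "norm (sum f (S - F)) \<le> e / 3" if "P S" for S
        using that by (intro small) (auto simp: P_def)
      ultimately have "dist (sum f F1) (sum f F2) = norm (sum f (F1 - F) - sum f (F2 - F))"
          "norm (sum f (F1 - F)) \<le> e / 3" "norm (sum f (F2 - F)) \<le> e / 3"
        using that by (simp_all add: dist_norm)
      then show ?thesis
        using \<open>e > 0\<close> norm_triangle_ineq4[of "sum f (F1 - F)" "sum f (F2 - F)"] by linarith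
    qed
    ultimately show ?thesis by blast
  qed
  then have "cauchy_filter (filtermap (sum f) (finite_subsets_at_top B))"
    by (simp add: cauchy_filter_metric_filtermap)
  moreover have "complete (UNIV::'b set)"
    by (rule complete_UNIV)
  ultimately obtain L where "(sum f \<longlongrightarrow> L) (finite_subsets_at_top B)"
    using complete_uniform[where S = "UNIV :: 'b set"] by (force simp add: filterlim_def)
  then show ?thesis
    unfolding summable_on_def has_sum_def by blast
qed

text \<open>Choose \<open>F\<close> so that its sum is within \<open>e\<close> of the supremum of
  all finite sums; disjoint additions cannot exceed what is left.\<close>

lemma sum_bounded_tail:
  fixes g :: "'a \<Rightarrow> real"
  assumes "\<And>u. u \<in> B \<Longrightarrow> 0 \<le> g u" "\<And>F. finite F \<Longrightarrow> F \<subseteq> B \<Longrightarrow> sum g F \<le> C" "e > 0"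
  shows "\<exists>F. finite F \<and> F \<subseteq> B \<and> (\<forall>G. finite G \<and> G \<subseteq> B - F \<longrightarrow> sum g G < e)"
proof -
  define s where "s = (SUP F\<in>{F. finite F \<and> F \<subseteq> B}. sum g F)"
  have bdd: "bdd_above (sum g ` {F. finite F \<and> F \<subseteq> B})"
    using assms(2) by (auto intro!: bdd_aboveI2)
  have "s - e < s" using assms(3) by simp
  then obtain F where F: "finite F" "F \<subseteq> B" "s - e < sum g F"
    unfolding s_def by (subst (asm) less_cSUP_iff[OF _ bdd]) auto
  have "sum g G < e" if "finite G" "G \<subseteq> B - F" for G
  proof -
    have "sum g (F \<union> G) = sum g F + sum g G"
      using that F by (intro sum.union_disjoint) auto
    moreover have "sum g (F \<union> G) \<le> s"
      unfolding s_def using that F by (intro cSUP_upper bdd) auto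
    ultimately show ?thesis using F(3) by linarith
  qed
  then show ?thesis using F by blast
qed

locale compact_hilbert_module = hilbert_module A act ip + compact_operator_cstar_algebra A
  for A :: "('h::chilbert_space \<Rightarrow>\<^sub>L 'h) set"
    and act :: "'u::{complex_normed_vector, banach} \<Rightarrow> ('h \<Rightarrow>\<^sub>L 'h) \<Rightarrow> 'u"
    and ip :: "'u \<Rightarrow> 'u \<Rightarrow> ('h \<Rightarrow>\<^sub>L 'h)"

section \<open>Orthonormal systems and Bessel's inequality\<close>

context hilbert_module begin

text \<open>The part of \<open>orthonormal_basis\<close> that refers neither to density nor to an
  ambient submodule; it is stable under subsets and unions of chains.\<close>

definition orthonormal_system :: "'u set \<Rightarrow> bool"
  where "orthonormal_system B \<longleftrightarrow>
    (\<forall>u\<in>B. minimal_projection A (ip u u)) \<and> (\<forall>u\<in>B. \<forall>v\<in>B. u \<noteq> v \<longrightarrow> ip u v = 0)"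

lemma orthonormal_basis_iff:
  "orthonormal_basis A act ip W B \<longleftrightarrow>
    B \<subseteq> W \<and> orthonormal_system B \<and> W \<subseteq> closure (submodule A act hull B)"
  by (auto simp: orthonormal_basis_def orthonormal_system_def)

text \<open>The elementary operator of the pair \<open>u\<close>, \<open>u\<close>. When
  \<open>ip u u\<close> is a minimal projection, it is the orthogonal projection onto the submodule
  generated by \<open>u\<close>.\<close>

abbreviation proj :: "'u \<Rightarrow> 'u \<Rightarrow> 'u"
  where "proj u x \<equiv> act u (ip u x)"

lemma ip_proj_orthonormal:
  assumes "orthonormal_system B" "u \<in> B" "v \<in> B"
  shows "ip v (proj u x) = (if u = v then ip v x else 0)"
  using assms unfolding orthonormal_system_def
  by (auto simp: ip_act ip_in ip_self_compose_ip)

lemma ip_sum_proj: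
  assumes "orthonormal_system B" "finite G" "G \<subseteq> B" "v \<in> B"
  shows "ip v (\<Sum>u\<in>G. proj u x) = (if v \<in> G then ip v x else 0)"
proof -
  have "ip v (\<Sum>u\<in>G. proj u x) = (\<Sum>u\<in>G. if u = v then ip v x else 0)"
    unfolding ip.sum_right using assms by (intro sum.cong refl ip_proj_orthonormal) auto
  then show ?thesis
    using assms(2) by simp
qed

lemma inner_proj: "x \<bullet> ip y (proj u y) x = norm (ip u y x) ^ 2"
  by (simp add: ip_act ip_in inner_ip[symmetric] power2_norm_eq_inner)

text \<open>The remainder of \<open>y\<close> is orthogonal to every member of \<open>G\<close>,
  hence to the partial sum itself.\<close>

lemma ip_sum_proj_self:
  assumes "orthonormal_system B" "finite G" "G \<subseteq> B"
  shows "ip (\<Sum>u\<in>G. proj u y) (\<Sum>u\<in>G. proj u y) = ip y (\<Sum>u\<in>G. proj u y)"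
proof -
  have "ip (y - (\<Sum>u\<in>G. proj u y)) v = 0" if "v \<in> G" for v
    using that subsetD[OF assms(3) that]
    by (subst ip_eq_zero_commute) (simp add: ip.diff_right ip_sum_proj[OF assms])
  then have "ip (y - (\<Sum>u\<in>G. proj u y)) (\<Sum>u\<in>G. proj u y) = 0"
    by (simp add: ip.sum_right ip_act ip_in)
  then show ?thesis by (simp add: ip.diff_left)
qed

lemma inner_sum_proj:
  assumes "orthonormal_system B" "finite G" "G \<subseteq> B"
  shows "x \<bullet> ip (\<Sum>u\<in>G. proj u y) (\<Sum>u\<in>G. proj u y) x = (\<Sum>u\<in>G. norm (ip u y x) ^ 2)"
  by (subst ip_sum_proj_self[OF assms])
    (simp add: ip.sum_right blinfun.sum_left inner_sum_right inner_proj)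

text \<open>For the partial sum \<open>p\<close>, the square of \<open>y - p\<close> is
  \<open>ip y y - ip p p\<close>; evaluate this positive operator at \<open>x\<close>.\<close>

lemma Bessel:
  assumes "orthonormal_system B" "finite G" "G \<subseteq> B"
  shows "(\<Sum>u\<in>G. norm (ip u y x) ^ 2) \<le> x \<bullet> ip y y x"
proof -
  define p where "p = (\<Sum>u\<in>G. proj u y)"
  have pp: "ip p p = ip y p"
    unfolding p_def using assms by (rule ip_sum_proj_self)
  have "ip p y = ip p p"
    using pp by (metis ip_adjoint ip_eqI)
  then have "ip (y - p) (y - p) = ip y y - ip p p"
    by (simp add: ip.diff_left ip.diff_right pp)
  then have "0 \<le> x \<bullet> ip y y x - x \<bullet> ip p p x"
    using ip_self_nonneg[of x "y - p"] by (simp add: blinfun.diff_left inner_diff_right)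
  then show ?thesis
    unfolding p_def inner_sum_proj[OF assms] by simp
qed

text \<open>The parallelogram law for the quadratic form, with the nonnegative term at
  \<open>x - y\<close> dropped.\<close>

lemma ip_self_add_le:
  "(x + y) \<bullet> ip u u (x + y) \<le> 2 * (x \<bullet> ip u u x) + 2 * (y \<bullet> ip u u y)"
proof -
  have "0 \<le> (x - y) \<bullet> ip u u (x - y)"
    by (rule ip_self_nonneg)
  then show ?thesis
    by (simp add: blinfun.add_right blinfun.diff_right inner_add_left inner_add_right
        inner_diff_left inner_diff_right)
qed

lemma submodule_act: "submodule A act W \<Longrightarrow> u \<in> W \<Longrightarrow> a \<in> A \<Longrightarrow> act u a \<in> W"
  by (simp add: submodule_def)

end

section \<open>Norm convergence of expansions and orthogonal projections\<close>

context compact_hilbert_module begin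

text \<open>Compactness of \<open>(y, y)\<close> reduces the uniform estimate over the unit ball of the Hilbert space
  to Bessel's inequality at finitely many vectors.\<close>

lemma Bessel_tail:
  assumes B: "orthonormal_system B" and "e > 0"
  shows "\<exists>F. finite F \<and> F \<subseteq> B \<and> (\<forall>G. finite G \<and> G \<subseteq> B - F \<longrightarrow> norm (\<Sum>u\<in>G. proj u y) \<le> e)"
proof -
  \<comment> \<open>The estimate below costs \<open>2 * d\<close> at the net point and
    \<open>4 * d\<close> for the deviation from it, in total \<open>6 * d\<close>.\<close>
  define d where "d = e ^ 2 / 8"
  have "d > 0" using \<open>e > 0\<close> by (simp add: d_def)
  obtain X where X: "finite X" "X \<subseteq> cball 0 1"
    "\<And>x. norm x \<le> 1 \<Longrightarrow> \<exists>z\<in>X. norm (ip y y (x - z)) < d"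
    using compact_operator_net[OF compact[OF ip_in] \<open>d > 0\<close>, of y y] by metis
  have "\<forall>z. \<exists>F. finite F \<and> F \<subseteq> B \<and> (\<forall>G. finite G \<and> G \<subseteq> B - F \<longrightarrow> (\<Sum>u\<in>G. norm (ip u y z) ^ 2) < d)"
    using Bessel[OF B] \<open>d > 0\<close> by (intro allI sum_bounded_tail) auto
  then obtain F where F: "\<And>z. finite (F z)" "\<And>z. F z \<subseteq> B"
    "\<And>z G. finite G \<Longrightarrow> G \<subseteq> B - F z \<Longrightarrow> (\<Sum>u\<in>G. norm (ip u y z) ^ 2) < d"
    by metis
  have "norm (\<Sum>u\<in>G. proj u y) \<le> e" if G: "finite G" "G \<subseteq> B - (\<Union>z\<in>X. F z)" for G
  proof -
    define p where "p = (\<Sum>u\<in>G. proj u y)"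
    have GB: "G \<subseteq> B" using G by blast
    have p_eq: "x \<bullet> ip p p x = (\<Sum>u\<in>G. norm (ip u y x) ^ 2)" for x
      unfolding p_def by (rule inner_sum_proj[OF B G(1) GB])
    have ball: "x \<bullet> ip p p x \<le> e ^ 2" if x: "norm x \<le> 1" for x
    proof -
      obtain z where z: "z \<in> X" "norm (ip y y (x - z)) < d"
        using X(3) x by blast
      have "norm z \<le> 1" using z(1) X(2) by auto
      \<comment> \<open>At the net point \<open>z\<close> the tail of the scalar Bessel series is
        small; at \<open>x - z\<close> the whole series is bounded through
        \<open>ip y y (x - z)\<close>, which is small by the choice of the net.\<close>
      have "x \<bullet> ip p p x \<le> 2 * (z \<bullet> ip p p z) + 2 * ((x - z) \<bullet> ip p p (x - z))"
        using ip_self_add_le[of z "x - z" p] by simp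
      moreover have "z \<bullet> ip p p z \<le> d"
      proof -
        have "G \<subseteq> B - F z" using G(2) z(1) by blast
        then show ?thesis
          unfolding p_eq using F(3)[OF G(1)] by (simp only: less_imp_le)
      qed
      moreover have "(x - z) \<bullet> ip p p (x - z) \<le> 2 * d"
      proof -
        have "(x - z) \<bullet> ip p p (x - z) \<le> (x - z) \<bullet> ip y y (x - z)"
          unfolding p_eq by (rule Bessel[OF B G(1) GB])
        also have "\<dots> \<le> norm (x - z) * norm (ip y y (x - z))"
          by (rule norm_cauchy_schwarz)
        also have "\<dots> \<le> 2 * d"
          using norm_triangle_ineq4[of x z] x \<open>norm z \<le> 1\<close> z(2) by (intro mult_mono) auto
        finally show ?thesis .
      qed
      ultimately have "x \<bullet> ip p p x \<le> 6 * d" by linarith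
      also have "\<dots> \<le> e ^ 2"
        using \<open>d > 0\<close> by (simp add: d_def)
      finally show ?thesis .
    qed
    have "norm p \<le> e"
    proof (rule norm_le_of_ip_self_le)
      fix x
      show "x \<bullet> ip p p x \<le> e ^ 2 * norm x ^ 2"
      proof (cases "x = 0")
        case False
        then have "(x \<bullet> ip p p x) / norm x ^ 2 \<le> e ^ 2"
          using ball[of "x /\<^sub>R norm x"]
          by (simp add: blinfun.scaleR_right divide_inverse power2_eq_square mult_ac)
        then show ?thesis
          using False by (simp add: pos_divide_le_eq)
      qed simp
    qed (use \<open>e > 0\<close> in simp)
    then show ?thesis by (simp add: p_def)
  qed
  then show ?thesis
    using F(1,2) X(1) by (intro exI[of _ "\<Union>z\<in>X. F z"] conjI) blast+
qed

lemma has_sum_proj: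
  assumes "orthonormal_system B"
  shows "((\<lambda>u. proj u y) has_sum (\<Sum>\<^sub>\<infinity>u\<in>B. proj u y)) B"
  by (intro has_sum_infsum summable_on_CauchyI Bessel_tail assms)

lemma ip_infsum_proj:
  assumes B: "orthonormal_system B" and v: "v \<in> B"
  shows "ip v (\<Sum>\<^sub>\<infinity>u\<in>B. proj u y) = ip v y"
proof -
  have "((\<lambda>u. ip v (proj u y)) has_sum ip v (\<Sum>\<^sub>\<infinity>u\<in>B. proj u y)) B"
    by (rule has_sum_bounded_linear[OF ip.bounded_linear_right has_sum_proj[OF B]])
  moreover have "((\<lambda>u. ip v (proj u y)) has_sum ip v y) B"
  proof -
    have "((\<lambda>u. ip v (proj u y)) has_sum ip v y) {v}"
      by (rule has_sum_finiteI) (simp_all add: ip_proj_orthonormal[OF B v v])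
    moreover have "((\<lambda>u. ip v (proj u y)) has_sum ip v y) {v} \<longleftrightarrow>
        ((\<lambda>u. ip v (proj u y)) has_sum ip v y) B"
      by (rule has_sum_cong_neutral) (use v ip_proj_orthonormal[OF B _ v] in \<open>auto split: if_splits\<close>)
    ultimately show ?thesis by blast
  qed
  ultimately show ?thesis by (rule has_sum_unique)
qed

lemma infsum_proj_in:
  assumes "orthonormal_system B" "B \<subseteq> W" "submodule A act W" "closed W"
  shows "(\<Sum>\<^sub>\<infinity>u\<in>B. proj u y) \<in> W"
proof -
  have "\<forall>\<^sub>F G in finite_subsets_at_top B. (\<Sum>u\<in>G. proj u y) \<in> W"
  proof (rule eventually_finite_subsets_at_top_weakI)
    fix G assume "finite G" "G \<subseteq> B"
    then show "(\<Sum>u\<in>G. proj u y) \<in> W"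
      using assms(2) by (intro submodule_sum[OF assms(3)] submodule_act[OF assms(3)] ip_in) blast
  qed
  then show ?thesis
    by (rule Lim_in_closed_set[OF assms(4) _ finite_subsets_at_top_neq_bot
          has_sum_proj[OF assms(1), unfolded has_sum_def]])
qed

text \<open>Take a minimal \<open>e\<close> below the support projection \<open>p\<close> of the
  normalised \<open>ip z z\<close>. If \<open>act z e\<close> were 0, then
  \<open>c o\<^sub>L e\<close> would be 0, although \<open>c o\<^sub>L c\<close> acts as the
  identity on \<open>p\<close> and hence fixes \<open>e\<close>.\<close>

lemma exists_normalized:
  assumes "z \<noteq> 0"
  obtains e r where "minimal_projection A e" "ip (r *\<^sub>R act z e) (r *\<^sub>R act z e) = e"
proof -
  define a where "a = ip z z"
  have "a \<noteq> 0" using assms ip_definite by (auto simp: a_def)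
  define c where "c = a /\<^sub>R norm a"
  have c: "c \<in> A" "self_adjoint c" "norm c = 1"
    using \<open>a \<noteq> 0\<close> by (auto simp: c_def a_def scaleR_closed ip_in self_adjoint_def blinfun.scaleR_left inner_ip)
  obtain p where p: "p \<in> projections" "(c o\<^sub>L c) o\<^sub>L p = p"
    using support_projection[OF c] by blast
  obtain e where e: "minimal_projection A e" "p o\<^sub>L e = e"
    using exists_minimal_projection_below[OF p(1)] by blast
  note eD = minimal_projectionD[OF e(1)]
  have "act z e \<noteq> 0"
  proof
    assume "act z e = 0"
    then have "a o\<^sub>L e = 0"
      using ip_act[OF eD(1), of z z] by (simp add: a_def ip.zero_right)
    then have "c o\<^sub>L e = 0"
      by (simp add: c_def bounded_bilinear.scaleR_left[OF bounded_bilinear_blinfun_compose])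
    then have "(c o\<^sub>L c) o\<^sub>L e = 0"
      by (simp add: blinfun_compose_assoc)
    moreover have "((c o\<^sub>L c) o\<^sub>L p) o\<^sub>L e = (c o\<^sub>L c) o\<^sub>L (p o\<^sub>L e)"
      by (rule blinfun_compose_assoc)
    ultimately have "e = 0"
      by (simp add: p(2) e(2))
    then show False using eD(4) by simp
  qed
  moreover have "act (act z e) e = act z e"
    using act_compose[OF eD(1) eD(1), of z] eD(2) by simp
  ultimately show thesis
    using normalize_minimal[OF e(1), of "act z e"] that[OF e(1)] by blast
qed

text \<open>Zorn's lemma gives a maximal system in \<open>W\<close>. If some \<open>x\<close>
  differed from its expansion, a normalised multiple of the difference could be added to the
  system.\<close>

lemma exists_orthonormal_basis:
  assumes W: "submodule A act W" "closed W"
  shows "\<exists>B. orthonormal_basis A act ip W B"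
proof -
  define \<B> where "\<B> = {B. B \<subseteq> W \<and> orthonormal_system B}"
  have "\<exists>M\<in>\<B>. \<forall>X\<in>\<B>. M \<subseteq> X \<longrightarrow> X = M"
  proof (rule subset_Zorn')
    fix C assume "subset.chain \<B> C"
    then have C: "C \<subseteq> \<B>" "\<And>X Y. X \<in> C \<Longrightarrow> Y \<in> C \<Longrightarrow> X \<subseteq> Y \<or> Y \<subseteq> X"
      by (auto simp: subset_chain_def)
    have "orthonormal_system (\<Union>C)"
      unfolding orthonormal_system_def
    proof (intro conjI ballI impI)
      show "minimal_projection A (ip u u)" if "u \<in> \<Union>C" for u
        using that C(1) by (auto simp: \<B>_def orthonormal_system_def)
      fix u v assume uv: "u \<in> \<Union>C" "v \<in> \<Union>C" "u \<noteq> v"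
      then obtain X where "X \<in> C" "u \<in> X" "v \<in> X"
        using C(2) by blast
      then show "ip u v = 0"
        using C(1) uv(3) by (auto simp: \<B>_def orthonormal_system_def)
    qed
    then show "\<Union>C \<in> \<B>"
      using C(1) by (auto simp: \<B>_def)
  qed
  then obtain B where "B \<in> \<B>" and max': "\<forall>X\<in>\<B>. B \<subseteq> X \<longrightarrow> X = B" ..
  then have B: "B \<subseteq> W" "orthonormal_system B"
    by (simp_all add: \<B>_def)
  have max: "X = B" if "X \<subseteq> W" "orthonormal_system X" "B \<subseteq> X" for X
    using max' that by (simp add: \<B>_def)
  have "x \<in> closure (submodule A act hull B)" if x: "x \<in> W" for x
  proof -
    define y where "y = (\<Sum>\<^sub>\<infinity>u\<in>B. proj u x)"
    have y: "y \<in> closure (submodule A act hull B)"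
      unfolding y_def
      by (rule infsum_proj_in[OF B(2) subset_trans[OF hull_subset closure_subset]
            submodule_closure[OF submodule_hull] closed_closure])
    have yW: "y \<in> W"
      unfolding y_def by (intro infsum_proj_in B W)
    have orth: "ip u (x - y) = 0" if "u \<in> B" for u
      using ip_infsum_proj[OF B(2) that, of x] by (simp add: y_def ip.diff_right)
    have "x - y = 0"
    proof (rule ccontr)
      assume "x - y \<noteq> 0"
      then obtain e r where e: "minimal_projection A e"
          "ip (r *\<^sub>R act (x - y) e) (r *\<^sub>R act (x - y) e) = e"
        using exists_normalized by blast
      define w where "w = r *\<^sub>R act (x - y) e"
      have wW: "w \<in> W"
        unfolding w_def
        by (intro submodule_scaleR submodule_act submodule_diff W x yW minimal_projectionD(1)[OF e(1)])
      have wB: "ip u w = 0" if "u \<in> B" for u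
        using orth[OF that] minimal_projectionD(1)[OF e(1)] by (simp add: w_def ip.scaleR_right ip_act)
      have "ip w u = 0" if "u \<in> B" for u
        using wB[OF that] by (subst ip_eq_zero_commute)
      moreover have "minimal_projection A (ip w w)"
        using e by (simp add: w_def)
      ultimately have "orthonormal_system (insert w B)"
        using B(2) wB by (simp add: orthonormal_system_def)
      then have "w \<in> B"
        using max[of "insert w B"] wW B(1) by blast
      then have "ip w w = 0" by (rule wB)
      then show False
        using e minimal_projectionD(4)[OF e(1)] by (simp add: w_def)
    qed
    then show ?thesis using y by simp
  qed
  then show ?thesis
    using B by (auto simp: orthonormal_basis_iff)
qed

text \<open>The remainder of \<open>x\<close> lies in \<open>W\<close>, hence in the closed hull of
  \<open>B\<close>, and is orthogonal to that hull; so it is orthogonal to itself.\<close>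

lemma orthonormal_basis_expansion:
  assumes B: "orthonormal_basis A act ip W B" and W: "submodule A act W" "closed W" and x: "x \<in> W"
  shows "((\<lambda>u. proj u x) has_sum x) B"
proof -
  have B': "B \<subseteq> W" "orthonormal_system B" "W \<subseteq> closure (submodule A act hull B)"
    using B by (auto simp: orthonormal_basis_iff)
  define z where "z = x - (\<Sum>\<^sub>\<infinity>u\<in>B. proj u x)"
  have "z \<in> W"
    unfolding z_def by (intro submodule_diff infsum_proj_in W x B')
  then have z: "z \<in> closure (submodule A act hull B)"
    using B'(3) by blast
  have "ip z u = 0" if "u \<in> B" for u
    using ip_infsum_proj[OF B'(2) that, of x]
    by (subst ip_eq_zero_commute) (simp add: z_def ip.diff_right)
  then have "ip z z = 0"
    using z by (rule orthocomplement_hull)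
  then have "z = 0" by (rule ip_definite)
  then show ?thesis
    using has_sum_proj[OF B'(2), of x] by (simp add: z_def)
qed

text \<open>The component in \<open>W\<close> is the expansion of \<open>x\<close> along a basis of
  \<open>W\<close>. Over general C*-algebras closed submodules need not be complemented, so this is
  where the choice of \<open>A\<close> matters.\<close>

lemma orthogonal_decomposition:
  assumes W: "submodule A act W" "closed W"
  obtains y where "y \<in> W" "x - y \<in> orthocomplement ip W"
proof -
  obtain B where "orthonormal_basis A act ip W B"
    using exists_orthonormal_basis[OF W] by blast
  then have B': "B \<subseteq> W" "orthonormal_system B" "W \<subseteq> closure (submodule A act hull B)"
    by (auto simp: orthonormal_basis_iff)
  define y where "y = (\<Sum>\<^sub>\<infinity>u\<in>B. proj u x)"
  have "y \<in> W"
    unfolding y_def by (intro infsum_proj_in W B')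
  moreover have "ip (x - y) u = 0" if "u \<in> B" for u
    using ip_infsum_proj[OF B'(2) that, of x]
    by (subst ip_eq_zero_commute) (simp add: y_def ip.diff_right)
  then have "ip (x - y) w = 0" if "w \<in> W" for w
    using B'(3) that by (rule orthocomplement_hull[OF _ subsetD])
  ultimately show thesis
    using that by (auto simp: orthocomplement_def)
qed

end

section \<open>Closed ranges and compact morphisms\<close>

text \<open>The Baire category half of the open mapping theorem, carried out inside the closed
  range: the closed image of some ball has interior points there.\<close>

lemma closed_range_approx_preimage:
  fixes F :: "'a::banach \<Rightarrow>\<^sub>L 'b::banach"
  assumes cl: "closed (range F)"
  obtains K where "K > 0"
    "\<And>y. y \<in> range F \<Longrightarrow> \<exists>x. norm x \<le> K * norm y \<and> norm (y - F x) \<le> norm y / 2"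
proof -
  define M where "M = range F"
  define X where "X = top_of_set M"
  define C where "C n = closure (F ` cball 0 (real n))" for n
  have M: "subspace M"
    unfolding M_def by (intro linear_subspace_image subspace_UNIV bounded_linear.linear blinfun.bounded_linear_right)
  have CM: "C n \<subseteq> M" for n
    unfolding C_def M_def by (intro closure_minimal cl) auto
  have "completely_metrizable_space X"
    unfolding X_def using cl completely_metrizable_space_closedin completely_metrizable_space_euclidean
    by (metis M_def closed_closedin)
  moreover have "X interior_of (\<Union>(range C)) \<noteq> {}"
  proof -
    have "F x \<in> C (nat \<lceil>norm x\<rceil>)" for x
      unfolding C_def by (intro subsetD[OF closure_subset]) (auto simp: real_nat_ceiling_ge)
    then have "\<Union>(range C) = M"
      using CM unfolding M_def by blast
    then show ?thesis
      using interior_of_topspace[of X] M unfolding X_def by (auto dest: subspace_0)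
  qed
  moreover have "closedin X (C n)" for n
    unfolding X_def using CM by (intro closed_subset) (auto simp: C_def)
  ultimately obtain n where "X interior_of (C n) \<noteq> {}"
    using Baire_category_alt[of X "range C"] by auto
  then obtain y0 U where U: "openin X U" "y0 \<in> U" "U \<subseteq> C n"
    unfolding interior_of_def by blast
  then obtain e where e: "e > 0" "\<And>y. y \<in> M \<Longrightarrow> dist y y0 < e \<Longrightarrow> y \<in> U"
    unfolding X_def openin_euclidean_subtopology_iff by blast
  have "y0 \<in> M" using U CM by blast
  \<comment> \<open>Approximate both \<open>y0 + y\<close> and \<open>y0\<close> by images of the
    ball of radius \<open>n\<close> and subtract; this moves the neighbourhood from
    \<open>y0\<close> to 0.\<close>
  have approx: "\<exists>x. norm x \<le> 2 * real n \<and> norm (y - F x) < d" if y: "y \<in> M" "norm y < e" "d > 0" for y d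
  proof -
    have "y0 + y \<in> C n" "y0 \<in> C n"
      using e y U \<open>y0 \<in> M\<close> subspace_add[OF M] by (auto simp: dist_norm)
    then obtain x1 x2 where x: "norm x1 \<le> n" "dist (F x1) (y0 + y) < d / 2" "norm x2 \<le> n" "dist (F x2) y0 < d / 2"
      using \<open>d > 0\<close> unfolding C_def closure_approachable by (fastforce dest!: spec[of _ "d / 2"])
    have "norm (x1 - x2) \<le> 2 * real n"
      using norm_triangle_ineq4[of x1 x2] x by simp
    moreover have "norm (y - F (x1 - x2)) < d"
    proof -
      have eq: "y - F (x1 - x2) = (F x2 - y0) - (F x1 - (y0 + y))"
        by (simp add: blinfun.diff_right)
      show ?thesis
        unfolding eq
        using norm_triangle_ineq4[of "F x2 - y0" "F x1 - (y0 + y)"] x(2,4)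
        unfolding dist_norm by linarith
    qed
    ultimately show ?thesis by blast
  qed
  \<comment> \<open>The summand 1 keeps \<open>K\<close> positive when \<open>n = 0\<close>.\<close>
  define K where "K = 4 * real n / e + 1"
  have "\<exists>x. norm x \<le> K * norm y \<and> norm (y - F x) \<le> norm y / 2" if y: "y \<in> M" for y
  proof (cases "y = 0")
    case False
    \<comment> \<open>Rescales \<open>y\<close> to norm \<open>e / 2\<close>, so an error of
      \<open>e / 4\<close> becomes half the norm of \<open>y\<close> after scaling back.\<close>
    define t where "t = e / (2 * norm y)"
    have t: "t > 0" "t * norm y = e / 2" using e(1) False by (auto simp: t_def)
    obtain x where x: "norm x \<le> 2 * real n" "norm (t *\<^sub>R y - F x) < e / 4"
      using approx[of "t *\<^sub>R y" "e / 4"] t e(1) subspace_scale[OF M y] by auto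
    have "norm (x /\<^sub>R t) \<le> K * norm y"
    proof -
      have "norm (x /\<^sub>R t) \<le> 2 * real n / t"
        using x(1) t(1) by (simp add: divide_simps)
      also have "\<dots> = 4 * real n / e * norm y"
        by (simp add: t_def)
      also have "\<dots> \<le> K * norm y"
        by (intro mult_right_mono) (simp_all add: K_def)
      finally show ?thesis .
    qed
    moreover have "norm (y - F (x /\<^sub>R t)) \<le> norm y / 2"
    proof -
      have "t *\<^sub>R y - F x = t *\<^sub>R (y - F (x /\<^sub>R t))"
        using t(1) by (simp add: blinfun.scaleR_right algebra_simps)
      then have "t * norm (y - F (x /\<^sub>R t)) < e / 4"
        using x(2) t(1) by simp
      also have "\<dots> = t * (norm y / 2)"
        using t(2) by simp
      finally show ?thesis using t(1) by simp
    qed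
    ultimately show ?thesis by blast
  qed (auto intro: exI[of _ 0])
  moreover have "K > 0"
    using e(1) by (auto simp: K_def intro: add_nonneg_pos)
  ultimately show thesis
    using that unfolding M_def by blast
qed

text \<open>Successive approximation: residuals at least halve at each step, so the approximate
  preimages form a series dominated by a geometric one, whose sum doubles the constant.\<close>

lemma closed_range_bounded_preimage:
  fixes F :: "'a::banach \<Rightarrow>\<^sub>L 'b::banach"
  assumes cl: "closed (range F)"
  obtains K where "K > 0" "\<forall>y\<in>range F. \<exists>x. F x = y \<and> norm x \<le> K * norm y"
proof -
  obtain K where K: "K > 0" "\<And>y. y \<in> range F \<Longrightarrow> \<exists>x. norm x \<le> K * norm y \<and> norm (y - F x) \<le> norm y / 2"
    using closed_range_approx_preimage[OF cl] by blast
  then obtain g where g: "\<And>y. y \<in> range F \<Longrightarrow> norm (g y) \<le> K * norm y"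
    "\<And>y. y \<in> range F \<Longrightarrow> norm (y - F (g y)) \<le> norm y / 2"
    by metis
  have "\<exists>x. F x = y \<and> norm x \<le> (2 * K) * norm y" if y: "y \<in> range F" for y
  proof -
    \<comment> \<open>\<open>r n\<close> is the residual left after \<open>n\<close> corrections; it
      stays in the range of \<open>F\<close>, so \<open>g\<close> keeps its estimates.\<close>
    define r where "r n = ((\<lambda>z. z - F (g z)) ^^ n) y" for n
    have r_Suc: "r (Suc n) = r n - F (g (r n))" for n by (simp add: r_def)
    have r_range: "r n \<in> range F" for n
    proof (induction n)
      case (Suc n)
      then show ?case
        unfolding r_Suc by (metis blinfun.diff_right rangeE rangeI)
    qed (simp add: r_def y)
    have r_norm: "norm (r n) \<le> norm y * (1 / 2) ^ n" for n
    proof (induction n)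
      case (Suc n)
      then show ?case
        using g(2)[OF r_range[of n]] by (simp add: r_Suc)
    qed (simp add: r_def)
    have g_norm: "norm (g (r n)) \<le> (K * norm y) * (1 / 2) ^ n" for n
      using order_trans[OF g(1)[OF r_range[of n]] mult_left_mono[OF r_norm[of n], of K]] K(1)
      by (simp add: mult.assoc)
    have sum_geo: "summable (\<lambda>n. (K * norm y) * (1 / 2) ^ n)"
      by (intro summable_mult summable_geometric) simp
    have sn: "summable (\<lambda>n. norm (g (r n)))"
      by (rule summable_comparison_test'[OF sum_geo, of 0]) (use g_norm in simp)
    then have sg: "summable (\<lambda>n. g (r n))"
      by (rule summable_norm_cancel)
    define x where "x = (\<Sum>n. g (r n))"
    have "norm x \<le> (\<Sum>n. norm (g (r n)))"
      unfolding x_def by (rule summable_norm[OF sn])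
    also have "\<dots> \<le> (\<Sum>n. (K * norm y) * (1 / 2) ^ n)"
      by (rule suminf_le[OF g_norm sn sum_geo])
    also have "\<dots> = 2 * K * norm y"
      by (subst suminf_mult) (simp_all add: suminf_geometric summable_geometric)
    finally have "norm x \<le> 2 * K * norm y" .
    moreover have "F x = y"
    proof -
      have "(\<lambda>n. F (g (r n))) sums F x"
        unfolding x_def by (intro bounded_linear.sums[OF blinfun.bounded_linear_right] summable_sums sg)
      moreover have "(\<Sum>i<n. F (g (r i))) = y - r n" for n
        by (induction n) (simp_all add: r_Suc, simp add: r_def)
      moreover have "(\<lambda>n. y - r n) \<longlonglongrightarrow> y - 0"
      proof (intro tendsto_intros)
        have "(\<lambda>n. norm y * (1 / 2) ^ n) \<longlonglongrightarrow> norm y * 0"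
          by (intro tendsto_intros LIMSEQ_realpow_zero) auto
        then show "r \<longlonglongrightarrow> 0"
          using r_norm by (intro Lim_null_comparison[of r "\<lambda>n. norm y * (1 / 2) ^ n"]) auto
      qed
      ultimately show ?thesis
        unfolding sums_def by (simp add: LIMSEQ_unique)
    qed
    ultimately show ?thesis by blast
  qed
  then show thesis
    using that[of "2 * K"] K(1) by auto
qed

section \<open>Compact morphisms and closed submodules\<close>

context compact_hilbert_module begin

text \<open>A finite-rank \<open>Q\<close> within 1/4 of \<open>P\<close> depends on
  \<open>x\<close> only through the finitely many coefficients \<open>ip (w i) x\<close>. When these
  are small, \<open>Q x\<close> contributes at most another quarter of the norm of
  \<open>x\<close>.\<close>

lemma compact_hom_small:
  assumes P: "P \<in> compact_hom A act ip act ip"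
  obtains n :: nat and w d where "d > 0"
    "\<forall>x. (\<forall>i<n. norm (ip (w i) x) \<le> d * norm x) \<longrightarrow> norm (P x) \<le> norm x / 2"
proof -
  have "P \<in> closure (finite_rank_hom A act ip act ip)"
    using P by (simp add: compact_hom_def)
  then obtain Q where Q: "Q \<in> finite_rank_hom A act ip act ip" "dist Q P < 1 / 4"
    unfolding closure_approachable by (meson zero_less_divide_1_iff zero_less_numeral)
  then obtain n :: nat and w v where Qx: "\<And>x. Q x = (\<Sum>i<n. act (v i) (ip (w i) x))"
    unfolding finite_rank_hom_def elementary_def by blast
  define c where "c = (\<Sum>i<n. norm (v i))"
  \<comment> \<open>Chosen so that \<open>c * d\<close> is at most 1/4; adding 1 avoids division by
    0 when \<open>c = 0\<close>.\<close>
  define d where "d = 1 / (4 * (1 + c))"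
  have "c \<ge> 0" by (simp add: c_def sum_nonneg)
  have "norm (P x) \<le> norm x / 2" if x: "\<And>i. i < n \<Longrightarrow> norm (ip (w i) x) \<le> d * norm x" for x
  proof -
    have "norm (Q x) \<le> (\<Sum>i<n. norm (v i) * (d * norm x))"
      unfolding Qx
      by (intro sum_norm_le order_trans[OF norm_act_le[OF ip_in]] mult_left_mono x) auto
    also have "\<dots> = (c * d) * norm x"
      by (simp add: c_def sum_distrib_right mult.assoc)
    also have "\<dots> \<le> 1 / 4 * norm x"
      using \<open>c \<ge> 0\<close> by (intro mult_right_mono) (simp_all add: d_def field_simps)
    finally have "norm (Q x) \<le> 1 / 4 * norm x" .
    moreover have "norm ((P - Q) x) \<le> 1 / 4 * norm x"
      using Q(2) by (intro order_trans[OF norm_blinfun] mult_right_mono)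
        (simp_all add: dist_norm norm_minus_commute)
    moreover have "P x = (P - Q) x + Q x" by (simp add: blinfun.diff_left)
    ultimately show ?thesis
      using norm_triangle_ineq[of "(P - Q) x" "Q x"] by simp
  qed
  moreover have "d > 0" using \<open>c \<ge> 0\<close> by (simp add: d_def)
  ultimately show thesis using that by blast
qed

lemma orthonormal_system_subset: "orthonormal_system B \<Longrightarrow> S \<subseteq> B \<Longrightarrow> orthonormal_system S"
  unfolding orthonormal_system_def by (simp add: subset_iff)

text \<open>Outside a finite set, members of \<open>B\<close> have small coefficients against every
  \<open>w i\<close>, so \<open>P u\<close> has norm at most 1/2, whereas the hypothesis forces
  \<open>ip u (P u)\<close> to have norm 1. That hypothesis covers both kernel vectors, where
  \<open>u + P u = 0\<close>, and vectors orthogonal to a range containing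
  \<open>u + P u\<close>.\<close>

lemma finite_orthonormal_system:
  assumes P: "P \<in> compact_hom A act ip act ip" and B: "orthonormal_system B"
    and ip: "\<And>u. u \<in> B \<Longrightarrow> ip u (u + P u) = 0"
  shows "finite B"
proof -
  obtain n :: nat and w d where d: "d > 0"
    and small: "\<forall>x. (\<forall>i<n. norm (ip (w i) x) \<le> d * norm x) \<longrightarrow> norm (P x) \<le> norm x / 2"
    by (rule compact_hom_small[OF P], rule that)
  have "\<forall>i. \<exists>F. finite F \<and> F \<subseteq> B \<and> (\<forall>G. finite G \<and> G \<subseteq> B - F \<longrightarrow> norm (\<Sum>u\<in>G. proj u (w i)) \<le> d)"
    by (intro allI Bessel_tail B d)
  from choice[OF this] obtain F where F: "\<forall>i. finite (F i) \<and> F i \<subseteq> B \<and>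
      (\<forall>G. finite G \<and> G \<subseteq> B - F i \<longrightarrow> norm (\<Sum>u\<in>G. proj u (w i)) \<le> d)" ..
  have "u \<in> (\<Union>i<n. F i)" if u: "u \<in> B" for u
  proof (rule ccontr)
    assume nu: "u \<notin> (\<Union>i<n. F i)"
    have min: "minimal_projection A (ip u u)"
      using B u by (simp add: orthonormal_system_def)
    have n1: "norm u = 1" by (rule norm_minimal[OF min])
    have "norm (ip (w i) u) \<le> d * norm u" if "i < n" for i
    proof -
      have "norm (proj u (w i)) \<le> d"
      proof -
        \<comment> \<open>A singleton outside \<open>F i\<close> is itself a tail, so the tail
          estimate bounds a single component.\<close>
        have "finite {u} \<and> {u} \<subseteq> B - F i" using u nu that by blast
        then have "norm (\<Sum>u\<in>{u}. proj u (w i)) \<le> d" using F by blast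
        then show ?thesis by simp
      qed
      moreover have "ip u (w i) = ip u (proj u (w i))"
        using ip_proj_orthonormal[OF B u u] by simp
      ultimately show ?thesis
        using norm_ip_le[of u "proj u (w i)"] norm_ip_commute[of "w i" u] by (simp add: n1)
    qed
    then have "norm (P u) \<le> 1 / 2"
      using small n1 by (metis)
    moreover have "norm (ip u u) = norm (ip u (P u))"
      using ip[OF u] by (simp add: ip.add_right eq_neg_iff_add_eq_0[symmetric])
    then have "1 = norm (ip u (P u))"
      by (simp add: norm_ip_self n1)
    ultimately show False
      using norm_ip_le[of u "P u"] n1 by simp
  qed
  then show ?thesis
    using F by (intro finite_subset[OF subsetI, of B "\<Union>i<n. F i"]) auto
qed

text \<open>\<open>S\<close> collects the basis vectors needed to approximate every
  \<open>w i\<close> within \<open>d\<close>. For \<open>x\<close> orthogonal to \<open>S\<close>,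
  the coefficient \<open>ip (w i) x\<close> sees only the approximation error.\<close>

lemma compact_hom_small_on_complement:
  assumes P: "P \<in> compact_hom A act ip act ip"
  obtains S where "finite S" "orthonormal_system S"
    "\<forall>x. (\<forall>u\<in>S. ip u x = 0) \<longrightarrow> norm (P x) \<le> norm x / 2"
proof -
  obtain n :: nat and w d where d: "d > 0"
    and small: "\<forall>x. (\<forall>i<n. norm (ip (w i) x) \<le> d * norm x) \<longrightarrow> norm (P x) \<le> norm x / 2"
    by (rule compact_hom_small[OF P], rule that)
  have UNIV: "submodule A act UNIV" by (simp add: submodule_def)
  obtain B where B: "orthonormal_basis A act ip UNIV B"
    using exists_orthonormal_basis[OF UNIV] by auto
  have "\<forall>i. \<exists>F. finite F \<and> F \<subseteq> B \<and> dist (\<Sum>u\<in>F. proj u (w i)) (w i) \<le> d"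
    using has_sum_finite_approximation[OF orthonormal_basis_expansion[OF B UNIV]] d by blast
  from choice[OF this] obtain F where
    F': "\<forall>i. finite (F i) \<and> F i \<subseteq> B \<and> dist (\<Sum>u\<in>F i. proj u (w i)) (w i) \<le> d" ..
  then have F: "finite (F i)" "F i \<subseteq> B" "dist (\<Sum>u\<in>F i. proj u (w i)) (w i) \<le> d" for i
    by simp_all
  have *: "\<forall>x. (\<forall>u\<in>(\<Union>i<n. F i). ip u x = 0) \<longrightarrow> norm (P x) \<le> norm x / 2"
  proof (intro allI impI, rule small[rule_format])
    fix x i assume x: "\<forall>u\<in>(\<Union>i<n. F i). ip u x = 0" and "i < n"
    have "ip (proj u (w i)) x = 0" if "u \<in> F i" for u
    proof -
      have "ip u x = 0" using x that \<open>i < n\<close> by blast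
      then show ?thesis
        using ip_act_left[OF ip_in ip_adjoint, of u u "w i" x] by simp
    qed
    then have "ip (w i) x = - ip ((\<Sum>u\<in>F i. proj u (w i)) - w i) x"
      by (simp add: ip.diff_left ip.sum_left)
    then have "norm (ip (w i) x) = norm (ip ((\<Sum>u\<in>F i. proj u (w i)) - w i) x)"
      by simp
    also have "\<dots> \<le> norm ((\<Sum>u\<in>F i. proj u (w i)) - w i) * norm x"
      by (rule norm_ip_le)
    also have "\<dots> \<le> d * norm x"
      using F(3)[of i] by (intro mult_right_mono) (simp_all add: dist_norm)
    finally show "norm (ip (w i) x) \<le> d * norm x" .
  qed
  have "orthonormal_system (\<Union>i<n. F i)"
  proof (rule orthonormal_system_subset)
    show "orthonormal_system B" using B by (simp only: orthonormal_basis_iff)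
  qed (use F(2) in blast)
  moreover have "finite (\<Union>i<n. F i)" using F(1) by simp
  ultimately show thesis
    using * by (intro that[of "\<Union>i<n. F i"])
qed

lemma orthocomplement_disjoint: "w \<in> M \<Longrightarrow> w \<in> orthocomplement ip M \<Longrightarrow> w = 0"
  using ip_definite by (simp add: orthocomplement_def)

text \<open>Removing from \<open>y\<close> its component in \<open>M\<close> leaves a vector
  \<open>z\<close> orthogonal to \<open>M\<close> and still fixed by \<open>e\<close>. After
  normalising it to \<open>z'\<close>, the enlarged submodule is the preimage of \<open>M\<close>
  under the continuous map \<open>v - proj z' v\<close>, hence closed. Minimality among submodules
  \<open>R\<close> serves to compare it with a range.\<close>

lemma closed_submodule_adjoin:
  assumes M: "submodule A act M" "closed M" and e: "minimal_projection A e" and y: "act y e = y"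
  shows "\<exists>N. submodule A act N \<and> closed N \<and> insert y M \<subseteq> N \<and>
    (\<forall>R. submodule A act R \<and> insert y M \<subseteq> R \<longrightarrow> N \<subseteq> R)"
proof -
  note eD = minimal_projectionD[OF e]
  obtain m where m: "m \<in> M" "y - m \<in> orthocomplement ip M"
    using orthogonal_decomposition[OF M] by blast
  define z where "z = y - m"
  have zM: "z \<in> orthocomplement ip M" using m by (simp add: z_def)
  \<comment> \<open>This difference lies in \<open>M\<close> and, like \<open>z\<close>, in the
    complement of \<open>M\<close>, so it vanishes.\<close>
  have "act z e - z = m - act m e"
    by (simp add: z_def act_diff_left[OF eD(1)] y)
  then have "act z e - z \<in> M"
    using M(1) m(1) eD(1) submodule_diff submodule_act by simp
  moreover have "act z e - z \<in> orthocomplement ip M"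
    using submodule_orthocomplement zM eD(1) submodule_diff submodule_act by blast
  ultimately have ze: "act z e = z"
    using orthocomplement_disjoint by force
  show ?thesis
  proof (cases "z = 0")
    case True
    then show ?thesis
      using M m(1) by (intro exI[of _ M]) (simp add: z_def)
  next
    case False
    obtain r where r: "r > 0" "ip (r *\<^sub>R z) (r *\<^sub>R z) = e"
      using normalize_minimal[OF e ze False] by blast
    define z' where "z' = r *\<^sub>R z"
    define N where "N = (\<lambda>v. v - proj z' v) -` M"
    have "continuous_on UNIV (\<lambda>v. v - proj z' v)"
      by (intro continuous_intros linear_continuous_on bounded_linear_elementary)
    then have "closed N"
      unfolding N_def using M(2) by (intro closed_vimage) auto
    moreover have N_iff: "v \<in> N \<longleftrightarrow> v - proj z' v \<in> M" for v
      by (simp add: N_def)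
    moreover have "submodule A act N"
      unfolding submodule_def
    proof (intro conjI ballI allI)
      show "0 \<in> N" using M(1) by (simp add: N_iff ip.zero_right submodule_def)
      show "u + v \<in> N" if "u \<in> N" "v \<in> N" for u v
      proof -
        have eq: "u + v - proj z' (u + v) = (u - proj z' u) + (v - proj z' v)"
          by (simp add: ip.add_right act_add_right ip_in)
        show ?thesis
          unfolding N_iff eq using that by (intro subspace_add[OF submodule_subspace[OF M(1)]]) (simp_all add: N_iff)
      qed
      show "c *\<^sub>C u \<in> N" if "u \<in> N" for c u
      proof -
        have eq: "c *\<^sub>C u - proj z' (c *\<^sub>C u) = c *\<^sub>C (u - proj z' u)"
          by (simp add: ip_scaleC_right act_scaleC_right ip_in scaleC_diff_right)
        show ?thesis
          unfolding N_iff eq using that M(1) by (simp add: N_iff submodule_def)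
      qed
      show "act u a \<in> N" if "u \<in> N" "a \<in> A" for u a
      proof -
        have eq: "act u a - proj z' (act u a) = act (u - proj z' u) a"
          using that(2) by (simp add: ip_act act_compose ip_in act_diff_left)
        show ?thesis
          unfolding N_iff eq using that by (intro submodule_act[OF M(1)]) (simp_all add: N_iff)
      qed
    qed
    moreover have "M \<subseteq> N"
    proof
      fix v assume "v \<in> M"
      then have "ip z' v = 0" using zM by (simp add: z'_def ip.scaleR_left orthocomplement_def)
      then show "v \<in> N" using \<open>v \<in> M\<close> by (simp add: N_def)
    qed
    moreover have "y \<in> N"
    proof -
      have "ip z' m = 0" using zM m(1) by (simp add: z'_def ip.scaleR_left orthocomplement_def)
      then have "ip z' y = ip z' z"
        by (simp add: z_def ip.diff_right)
      also have "\<dots> = (1 / r) *\<^sub>R e"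
        using r by (simp add: z'_def ip.scaleR_left ip.scaleR_right flip: r(2))
      finally have "proj z' y = z"
        using r(1) by (simp add: act_scaleR_right eD(1) z'_def act_scaleR_left ze)
      then show ?thesis using m(1) by (simp add: N_def z_def)
    qed
    moreover have "N \<subseteq> R" if R: "submodule A act R" "insert y M \<subseteq> R" for R
    proof
      fix v assume "v \<in> N"
      then have "v - proj z' v \<in> R" using R(2) by (auto simp: N_def)
      moreover have "z' \<in> R"
        unfolding z'_def z_def using R m(1) by (intro submodule_scaleR submodule_diff) auto
      then have "proj z' v \<in> R"
        by (intro submodule_act R ip_in)
      ultimately have "(v - proj z' v) + proj z' v \<in> R"
        using R(1) unfolding submodule_def by blast
      then show "v \<in> R" by simp
    qed
    ultimately show ?thesis by (intro exI[of _ N]) simp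
  qed
qed

lemma closed_submodule_adjoin_finite:
  assumes "finite S" "\<And>y. y \<in> S \<Longrightarrow> \<exists>e. minimal_projection A e \<and> act y e = y"
    and M: "submodule A act M" "closed M"
  shows "\<exists>N. submodule A act N \<and> closed N \<and> M \<union> S \<subseteq> N \<and>
    (\<forall>R. submodule A act R \<and> M \<union> S \<subseteq> R \<longrightarrow> N \<subseteq> R)"
  using assms(1,2)
proof (induction S)
  case empty
  then show ?case using M by (intro exI[of _ M]) simp
next
  case (insert y S)
  have "\<exists>N. submodule A act N \<and> closed N \<and> M \<union> S \<subseteq> N \<and>
      (\<forall>R. submodule A act R \<and> M \<union> S \<subseteq> R \<longrightarrow> N \<subseteq> R)"
    by (rule insert.IH) (rule insert.prems, simp)
  then obtain N where N: "submodule A act N" "closed N" "M \<union> S \<subseteq> N"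
    "\<forall>R. submodule A act R \<and> M \<union> S \<subseteq> R \<longrightarrow> N \<subseteq> R"
    by (elim exE conjE)
  obtain e where e: "minimal_projection A e" "act y e = y" using insert.prems[of y] by blast
  obtain N' where N': "submodule A act N'" "closed N'" "insert y N \<subseteq> N'"
    "\<forall>R. submodule A act R \<and> insert y N \<subseteq> R \<longrightarrow> N' \<subseteq> R"
    using closed_submodule_adjoin[OF N(1,2) e] by (elim exE conjE)
  have "N' \<subseteq> R" if "submodule A act R" "M \<union> insert y S \<subseteq> R" for R
    using N(4)[rule_format, of R] N'(4)[rule_format, of R] that by simp
  moreover have "M \<union> insert y S \<subseteq> N'"
    using N(3) N'(3) by blast
  ultimately show ?case using N'(1,2) by (intro exI[of _ N']) simp
qed

end

section \<open>Fredholm morphisms\<close>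

context compact_hilbert_module begin

text \<open>With a finite basis, the orthogonal projection onto \<open>W\<close> is a finite sum of
  elementary operators, which later makes it a compact morphism.\<close>

lemma finite_basis_complement:
  assumes B: "orthonormal_basis A act ip W B" "finite B" and W: "submodule A act W" "closed W"
  shows "(\<Sum>u\<in>B. proj u x) \<in> W" "x - (\<Sum>u\<in>B. proj u x) \<in> orthocomplement ip W"
proof -
  have B': "B \<subseteq> W" "orthonormal_system B" "W \<subseteq> closure (submodule A act hull B)"
    using B by (auto simp only: orthonormal_basis_iff)
  show "(\<Sum>u\<in>B. proj u x) \<in> W"
    using infsum_proj_in[OF B'(2,1) W, of x] B(2) by simp
  have "ip (x - (\<Sum>u\<in>B. proj u x)) u = 0" if "u \<in> B" for u
    using ip_infsum_proj[OF B'(2) that, of x] B(2)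
    by (subst ip_eq_zero_commute) (simp add: ip.diff_right)
  then have "ip (x - (\<Sum>u\<in>B. proj u x)) w = 0" if "w \<in> W" for w
    using B'(3) that by (rule orthocomplement_hull[OF _ subsetD])
  then show "x - (\<Sum>u\<in>B. proj u x) \<in> orthocomplement ip W"
    by (simp add: orthocomplement_def)
qed

lemma ip_proj_commute: "ip (proj u x) y = ip x (proj u y)"
  using ip_act_left[OF ip_in ip_adjoint, of u u x y] by (simp add: ip_act ip_in)

text \<open>The basis returned is the very one chosen in \<open>module_dim\<close>; existence of
  bases ensures that this choice is a basis.\<close>

lemma module_dim_finite_iff:
  assumes "submodule A act W" "closed W"
  obtains B where "orthonormal_basis A act ip W B" "BNF_Cardinal_Arithmetic.cfinite (module_dim A act ip W) \<longleftrightarrow> finite B"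
proof -
  have "orthonormal_basis A act ip W (SOME B. orthonormal_basis A act ip W B)"
    by (rule someI_ex) (rule exists_orthonormal_basis[OF assms])
  moreover have "BNF_Cardinal_Arithmetic.cfinite (module_dim A act ip W) \<longleftrightarrow> finite (SOME B. orthonormal_basis A act ip W B)"
    by (simp add: module_dim_def BNF_Cardinal_Arithmetic.cfinite_def Field_card_of)
  ultimately show thesis by (rule that)
qed

end

section \<open>Adjointable maps between two modules\<close>

locale hilbert_module_pair =
  U: compact_hilbert_module A actU ipU + V: compact_hilbert_module A actV ipV
  for A :: "('h::chilbert_space \<Rightarrow>\<^sub>L 'h) set"
    and actU :: "'u::{complex_normed_vector, banach} \<Rightarrow> ('h \<Rightarrow>\<^sub>L 'h) \<Rightarrow> 'u"
    and ipU :: "'u \<Rightarrow> 'u \<Rightarrow> ('h \<Rightarrow>\<^sub>L 'h)"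
    and actV :: "'v::{complex_normed_vector, banach} \<Rightarrow> ('h \<Rightarrow>\<^sub>L 'h) \<Rightarrow> 'v"
    and ipV :: "'v \<Rightarrow> 'v \<Rightarrow> ('h \<Rightarrow>\<^sub>L 'h)"
begin

lemma adjoint_swap:
  assumes "\<And>u v. ipV (L u) v = ipU u (M v)"
  shows "ipU (M v) u = ipV v (L u)"
  by (rule U.ip_eqI) (simp add: assms[symmetric] V.ip_adjoint)

lemma ip_extensional:
  assumes "\<And>v. ipV w v = ipV w' v"
  shows "w = w'"
proof -
  have "ipV (w - w') (w - w') = 0"
    using assms[of "w - w'"] by (simp add: V.ip.diff_left)
  then have "w - w' = 0" by (rule V.ip_definite)
  then show ?thesis by simp
qed

text \<open>Elements are determined by their products, and an adjoint moves each operation to the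
  other side; so any function with an adjoint is automatically linear over the scalars and over
  \<open>A\<close>.\<close>

lemma adjointable_linear:
  assumes L: "\<And>u v. ipV (L u) v = ipU u (M v)"
  shows "L (u + u') = L u + L u'" "L (r *\<^sub>R u) = r *\<^sub>R L u" "L (z *\<^sub>C u) = z *\<^sub>C L u"
    "a \<in> A \<Longrightarrow> L (actU u a) = actV (L u) a"
proof -
  show "L (u + u') = L u + L u'"
    by (rule ip_extensional) (simp add: L U.ip.add_left V.ip.add_left)
  show "L (r *\<^sub>R u) = r *\<^sub>R L u"
    by (rule ip_extensional) (simp add: L U.ip.scaleR_left V.ip.scaleR_left)
  show "L (z *\<^sub>C u) = z *\<^sub>C L u"
  proof (rule ip_extensional)
    fix v
    \<comment> \<open>Complex scalars are pulled out in the second argument, so the product is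
      turned around first and turned back afterwards.\<close>
    have "ipV v (L (z *\<^sub>C u)) = ipV v (z *\<^sub>C L u)"
      unfolding adjoint_swap[OF L, symmetric] V.ip_scaleC_right U.ip_scaleC_right ..
    then show "ipV (L (z *\<^sub>C u)) v = ipV (z *\<^sub>C L u) v"
      by (metis V.ip_adjoint V.ip_eqI)
  qed
  show "L (actU u a) = actV (L u) a" if a: "a \<in> A"
  proof (rule ip_extensional)
    fix v
    obtain b where b: "b \<in> A" "is_adjoint b a"
      using U.adjoint_closed[OF a] by blast
    show "ipV (L (actU u a)) v = ipV (actV (L u) a) v"
      by (simp add: L U.ip_act_left[OF a b(2)] V.ip_act_left[OF a b(2)])
  qed
qed

text \<open>Makes a morphism out of a function obtained by choice, from an adjoint and a norm bound
  alone.\<close>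

lemma adjointable_hom_exists:
  assumes L: "\<And>u v. ipV (L u) v = ipU u (M v)" and bound: "\<And>u. norm (L u) \<le> C * norm u"
  obtains T where "T \<in> adjointable_hom A actU ipU actV ipV" "blinfun_apply T = L"
proof -
  have "bounded_linear L"
    by (rule bounded_linear_intro[where K = C])
      (use bound in \<open>simp_all add: adjointable_linear[OF L] mult.commute\<close>)
  then have T: "blinfun_apply (Blinfun L) = L"
    by (rule bounded_linear_Blinfun_apply)
  have "Blinfun L \<in> adjointable_hom A actU ipU actV ipV"
    unfolding adjointable_hom_def complex_homogeneous_def mem_Collect_eq T
    by (intro conjI allI ballI exI[of _ M] L adjointable_linear(3,4)[OF L])
  then show thesis using T by (rule that)
qed

end

context compact_hilbert_module begin

text \<open>The sum is its own adjoint. The sign matches the errors of a parametrix, which are minus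
  the projections onto the kernel and onto the complement of the range.\<close>

lemma neg_finite_proj_compact_hom:
  assumes S: "finite S" and P: "\<And>x. blinfun_apply P x = - (\<Sum>u\<in>S. proj u x)"
  shows "P \<in> compact_hom A act ip act ip"
proof -
  interpret self: hilbert_module_pair A act ip act ip ..
  have adj: "ip (P x) y = ip x (P y)" for x y
    by (simp add: P ip.minus_left ip.minus_right ip.sum_left ip.sum_right ip_proj_commute)
  have P_hom: "P \<in> adjointable_hom A act ip act ip"
    unfolding adjointable_hom_def complex_homogeneous_def mem_Collect_eq
    by (intro conjI allI ballI exI[of _ "blinfun_apply P"] adj self.adjointable_linear(3,4)[of P P, OF adj])
  obtain f where f: "bij_betw f {0..<card S} S"
    using ex_bij_betw_nat_finite[OF S] by blast
  have "P x = (\<Sum>i<card S. elementary ip act (f i) (- f i) x)" for x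
  proof -
    have "act (- u) (ip u x) = - proj u x" for u
      using act_scaleR_left[OF ip_in, of "-1" u u x] by simp
    then have "P x = (\<Sum>u\<in>S. elementary ip act u (- u) x)"
      by (simp add: P elementary_def sum_negf)
    also have "\<dots> = (\<Sum>i<card S. elementary ip act (f i) (- f i) x)"
      using sum.reindex_bij_betw[OF f, of "\<lambda>u. elementary ip act u (- u) x"]
      by (simp add: atLeast0LessThan)
    finally show ?thesis .
  qed
  then have "P \<in> finite_rank_hom A act ip act ip"
    unfolding finite_rank_hom_def mem_Collect_eq
    by (intro conjI P_hom exI[of _ "card S"] exI[of _ f] exI[of _ "\<lambda>i. - f i"] allI)
  then show ?thesis
    unfolding compact_hom_def using P_hom closure_subset by blast
qed

end

context hilbert_module_pair begin

lemma submodule_image: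
  assumes L: "\<And>u v. ipV (L u) v = ipU u (M v)" and W: "submodule A actU W"
  shows "submodule A actV (L ` W)"
proof -
  have "L 0 = 0" using adjointable_linear(2)[OF L, of 0 0] by simp
  then have "0 \<in> L ` W" using W unfolding submodule_def by force
  moreover have "v + v' \<in> L ` W" if "v \<in> L ` W" "v' \<in> L ` W" for v v'
    using that W adjointable_linear(1)[OF L, symmetric] by (auto simp: submodule_def)
  moreover have "z *\<^sub>C v \<in> L ` W" if "v \<in> L ` W" for z v
    using that W adjointable_linear(3)[OF L, symmetric] by (auto simp: submodule_def)
  moreover have "actV v a \<in> L ` W" if "v \<in> L ` W" "a \<in> A" for v a
    using that W adjointable_linear(4)[OF L, symmetric] by (auto simp: submodule_def)
  ultimately show ?thesis
    unfolding submodule_def by blast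
qed

lemma closed_image_bounded_below:
  assumes L: "\<And>u v. ipV (L u) v = ipU u (M v)" and C: "\<And>u. norm (L u) \<le> C * norm u"
    and W: "submodule A actU W" "closed W"
    and e: "e > 0" "\<And>u. u \<in> W \<Longrightarrow> e * norm u \<le> norm (L u)"
  shows "closed (L ` W)"
proof -
  have "bounded_linear L"
    by (rule bounded_linear_intro[where K = C])
      (use C in \<open>simp_all add: adjointable_linear[OF L] mult.commute\<close>)
  then have "complete (L ` W)"
    using e W U.submodule_subspace by (intro complete_isometric_image[of e]) (auto simp: complete_eq_closed)
  then show ?thesis by (rule complete_imp_closed)
qed

end

section \<open>Kernel and range of an adjointable morphism\<close>

locale adjointable_morphism = hilbert_module_pair A actU ipU actV ipV
  for A :: "('h::chilbert_space \<Rightarrow>\<^sub>L 'h) set"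
    and actU :: "'u::{complex_normed_vector, banach} \<Rightarrow> ('h \<Rightarrow>\<^sub>L 'h) \<Rightarrow> 'u"
    and ipU :: "'u \<Rightarrow> 'u \<Rightarrow> ('h \<Rightarrow>\<^sub>L 'h)"
    and actV :: "'v::{complex_normed_vector, banach} \<Rightarrow> ('h \<Rightarrow>\<^sub>L 'h) \<Rightarrow> 'v"
    and ipV :: "'v \<Rightarrow> 'v \<Rightarrow> ('h \<Rightarrow>\<^sub>L 'h)" +
  fixes F :: "'u \<Rightarrow>\<^sub>L 'v" and Fa :: "'v \<Rightarrow> 'u"
  assumes adjoint: "ipV (F u) v = ipU u (Fa v)"
begin

sublocale rev: hilbert_module_pair A actV ipV actU ipU ..

lemma adjoint': "ipU (Fa v) u = ipV v (F u)"
  by (rule adjoint_swap[of F Fa, OF adjoint])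

lemmas F_linear = adjointable_linear[of F Fa, OF adjoint]

lemma norm_Fa: "norm (Fa v) \<le> norm F * norm v"
proof -
  have "norm (Fa v) ^ 2 = norm (ipV v (F (Fa v)))"
    by (simp flip: adjoint' U.norm_ip_self)
  also have "\<dots> \<le> norm v * norm (F (Fa v))"
    by (rule V.norm_ip_le)
  also have "\<dots> \<le> norm v * (norm F * norm (Fa v))"
    by (intro mult_left_mono norm_blinfun) simp
  finally show ?thesis
    by (cases "Fa v = 0") (simp_all add: power2_eq_square mult_ac)
qed

abbreviation ker :: "'u set" where "ker \<equiv> {u. F u = 0}"
abbreviation im :: "'v set" where "im \<equiv> range (blinfun_apply F)"

lemma submodule_ker: "submodule A actU ker"
  using F_linear V.act_zero_left by (auto simp: submodule_def)

lemma closed_ker: "closed ker"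
  by (intro closed_Collect_eq continuous_intros)

lemma submodule_UNIV: "submodule A actU UNIV"
  by (simp add: submodule_def)

lemma submodule_im: "submodule A actV im"
  using submodule_image[of F Fa, OF adjoint submodule_UNIV] .

lemma closed_range_if_left_inverse:
  assumes P: "P \<in> compact_hom A actU ipU actU ipU" and G: "G o\<^sub>L F = id_blinfun + P"
  shows "closed im"
proof -
  obtain S where S: "finite S" "U.orthonormal_system S"
    "\<forall>x. (\<forall>u\<in>S. ipU u x = 0) \<longrightarrow> norm (P x) \<le> norm x / 2"
    using U.compact_hom_small_on_complement[OF P] .
  define W where "W = orthocomplement ipU S"
  have W: "submodule A actU W" "closed W"
    unfolding W_def by (rule U.submodule_orthocomplement U.closed_orthocomplement)+
  define e where "e = 1 / (2 * (norm G + 1))"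
  have "norm G + 1 > 0" by (simp add: add_nonneg_pos)
  then have "e > 0" by (simp add: e_def)
  have below: "e * norm x \<le> norm (F x)" if x: "x \<in> W" for x
  proof -
    have "ipU u x = 0" if "u \<in> S" for u
      using x that by (subst U.ip_eq_zero_commute) (simp add: W_def orthocomplement_def)
    then have "norm (P x) \<le> norm x / 2" using S(3) by blast
    moreover have "G (F x) = x + P x"
      using arg_cong[OF G, of "\<lambda>T. blinfun_apply T x"] by (simp add: blinfun.add_left)
    ultimately have "norm x / 2 \<le> norm (G (F x))"
      using norm_diff_ineq[of x "P x"] by simp
    also have "\<dots> \<le> norm G * norm (F x)"
      by (rule norm_blinfun)
    also have "\<dots> \<le> (norm G + 1) * norm (F x)"
      by (intro mult_right_mono) simp_all
    finally show ?thesis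
      using \<open>norm G + 1 > 0\<close> by (simp add: e_def field_simps)
  qed
  have M: "submodule A actV (F ` W)" "closed (F ` W)"
    by (rule submodule_image[of F Fa, OF adjoint W(1)])
      (rule closed_image_bounded_below[of F Fa "norm F", OF adjoint norm_blinfun W \<open>e > 0\<close> below])
  \<comment> \<open>Each \<open>u\<close> in \<open>S\<close> is fixed by the minimal projection
    \<open>ipU u u\<close>, and \<open>A\<close>-linearity passes this on to
    \<open>F u\<close>.\<close>
  have FS: "\<exists>e. minimal_projection A e \<and> actV y e = y" if "y \<in> F ` S" for y
  proof -
    obtain u where u: "y = F u" "u \<in> S"
      using \<open>y \<in> F ` S\<close> by (rule imageE)
    have min: "minimal_projection A (ipU u u)"
      using S(2) u(2) by (simp add: U.orthonormal_system_def)
    then show ?thesis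
      using F_linear(4)[OF U.ip_in, of u u u] U.act_ip_self[OF min] u(1) by metis
  qed
  have "\<exists>N. submodule A actV N \<and> closed N \<and> F ` W \<union> F ` S \<subseteq> N \<and>
      (\<forall>R. submodule A actV R \<and> F ` W \<union> F ` S \<subseteq> R \<longrightarrow> N \<subseteq> R)"
    using FS by (rule V.closed_submodule_adjoin_finite[OF finite_imageI[OF S(1)] _ M])
  then obtain N where N: "submodule A actV N" "closed N" "F ` W \<union> F ` S \<subseteq> N"
    "\<forall>R. submodule A actV R \<and> F ` W \<union> F ` S \<subseteq> R \<longrightarrow> N \<subseteq> R"
    by (elim exE conjE)
  have "N \<subseteq> im"
    using N(4)[rule_format, of im] submodule_im by (simp add: image_mono)
  moreover have "F x \<in> N" for x
  proof -
    define p where "p = (\<Sum>u\<in>S. U.proj u x)"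
    have "ipU u (x - p) = 0" if "u \<in> S" for u
      using U.ip_sum_proj[OF S(2,1) subset_refl that, of x] that by (simp add: p_def U.ip.diff_right)
    then have "x - p \<in> W"
      by (simp add: W_def orthocomplement_def U.ip_eq_zero_commute[of "x - p"])
    then have "F (x - p) \<in> N" using N(3) by blast
    moreover have "F p = (\<Sum>u\<in>S. actV (F u) (ipU u x))"
      by (simp add: p_def blinfun.sum_right F_linear(4) U.ip_in)
    then have "F p \<in> N"
      using N(3) by (auto intro!: V.submodule_sum[OF N(1)] V.submodule_act[OF N(1)] U.ip_in)
    ultimately have "F (x - p) + F p \<in> N"
      by (rule subspace_add[OF V.submodule_subspace[OF N(1)]])
    then show ?thesis by (simp add: blinfun.diff_right)
  qed
  ultimately have "im = N" by blast
  then show ?thesis using N(2) by simp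
qed

text \<open>\<open>Fa\<close> maps \<open>im\<close> onto the complement of \<open>ker\<close>: its image there is closed because \<open>F\<close> has bounded
  preimages, and a vector orthogonal to that image lies in \<open>ker\<close>.\<close>

lemma adjoint_surj:
  assumes im: "closed im" and x: "x \<in> orthocomplement ipU ker"
  shows "x \<in> Fa ` im"
proof -
  obtain C where C: "C > 0" "\<forall>y\<in>im. \<exists>x. F x = y \<and> norm x \<le> C * norm y"
    using closed_range_bounded_preimage[OF im] .
  \<comment> \<open>Write \<open>m = F x\<close> with a bounded preimage; then
    \<open>ipV m m\<close> equals \<open>ipU x (Fa m)\<close>, and one factor \<open>norm m\<close>
    cancels.\<close>
  have below: "(1 / C) * norm m \<le> norm (Fa m)" if "m \<in> im" for m
  proof (cases "m = 0")
    case False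
    obtain x where x: "F x = m" "norm x \<le> C * norm m" using C(2) \<open>m \<in> im\<close> by blast
    have "norm m ^ 2 = norm (ipU x (Fa m))"
      by (simp add: x(1) flip: adjoint V.norm_ip_self)
    also have "\<dots> \<le> (C * norm m) * norm (Fa m)"
      by (rule order_trans[OF U.norm_ip_le mult_right_mono[OF x(2)]]) simp
    finally show ?thesis
      using False C(1) by (simp add: power2_eq_square field_simps)
  qed simp
  define R where "R = Fa ` im"
  have R: "submodule A actU R" "closed R"
    unfolding R_def
    by (rule rev.submodule_image[of Fa F, OF adjoint' submodule_im])
      (rule rev.closed_image_bounded_below[of Fa F "norm F" _ "1 / C", OF adjoint' norm_Fa submodule_im im _ below],
       use C(1) in simp_all)
  obtain r where r: "r \<in> R" "x - r \<in> orthocomplement ipU R"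
    using U.orthogonal_decomposition[OF R] .
  \<comment> \<open>Testing against this particular element of \<open>R\<close> gives the square of
    \<open>F (x - r)\<close>, so \<open>x - r\<close> lies in the kernel, to which \<open>x\<close>
    is orthogonal.\<close>
  have "ipU (x - r) (Fa (F (x - r))) = 0"
    using r(2) by (simp add: orthocomplement_def R_def)
  then have "F (x - r) = 0"
    using V.ip_definite by (simp flip: adjoint)
  then have "ipU x (x - r) = 0"
    using x by (simp add: orthocomplement_def)
  then have "ipU (x - r) x = 0"
    by (subst U.ip_eq_zero_commute)
  moreover have "ipU (x - r) r = 0"
    using r by (simp add: orthocomplement_def)
  ultimately have "ipU (x - r) (x - r) = 0"
    by (simp add: U.ip.diff_right)
  then have "x - r = 0" by (rule U.ip_definite)
  then show ?thesis using r(1) by (simp add: R_def)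
qed

text \<open>\<open>p\<close> and \<open>q\<close> are the projections onto the kernel and onto the
  complement of the range. \<open>L\<close> sends \<open>y\<close> to the preimage of
  \<open>y - q y\<close> orthogonal to the kernel, and this one map serves as left and right
  parametrix with errors \<open>- p\<close> and \<open>- q\<close>.\<close>

lemma fredholm_if_finite:
  assumes F: "F \<in> adjointable_hom A actU ipU actV ipV" and im: "closed im"
    and S: "orthonormal_basis A actU ipU ker S" "finite S"
    and T: "orthonormal_basis A actV ipV (orthocomplement ipV im) T" "finite T"
  shows "F \<in> fredholm_hom A actU ipU actV ipV"
proof -
  define p where "p x = (\<Sum>u\<in>S. U.proj u x)" for x
  define q where "q y = (\<Sum>u\<in>T. V.proj u y)" for y
  have p: "p x \<in> ker" "x - p x \<in> orthocomplement ipU ker" for x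
    unfolding p_def by (rule U.finite_basis_complement[OF S submodule_ker closed_ker])+
  have q: "q y \<in> orthocomplement ipV im" "y - q y \<in> orthocomplement ipV (orthocomplement ipV im)" for y
    unfolding q_def
    by (rule V.finite_basis_complement[OF T V.submodule_orthocomplement V.closed_orthocomplement])+
  \<comment> \<open>A closed range is complemented, so it contains its double orthogonal
    complement.\<close>
  have q_im: "y - q y \<in> im" for y
  proof -
    obtain m where m: "m \<in> im" "(y - q y) - m \<in> orthocomplement ipV im"
      using V.orthogonal_decomposition[OF submodule_im im] .
    have "m \<in> orthocomplement ipV (orthocomplement ipV im)"
      using m(1) by (auto simp: orthocomplement_def V.ip_eq_zero_commute[of m])
    then have "(y - q y) - m \<in> orthocomplement ipV (orthocomplement ipV im)"
      using q(2) V.submodule_orthocomplement V.submodule_diff by blast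
    then have "(y - q y) - m = 0"
      by (rule V.orthocomplement_disjoint[OF m(2)])
    then show ?thesis using m(1) by simp
  qed
  have q0: "q (F x) = 0" for x
  proof -
    have "ipV u (F x) = 0" if "u \<in> T" for u
      using T(1) that by (auto simp: orthonormal_basis_def orthocomplement_def)
    then show ?thesis by (simp add: q_def)
  qed
  have "bounded_linear p" "bounded_linear q"
    unfolding p_def q_def
    by (intro bounded_linear_sum U.bounded_linear_elementary V.bounded_linear_elementary)+
  obtain Cp where Cp: "\<And>x. norm (p x) \<le> norm x * Cp" "Cp \<ge> 0"
    using bounded_linear.nonneg_bounded[OF \<open>bounded_linear p\<close>] by blast
  obtain Cq where Cq: "\<And>x. norm (q x) \<le> norm x * Cq" "Cq \<ge> 0"
    using bounded_linear.nonneg_bounded[OF \<open>bounded_linear q\<close>] by blast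
  obtain C where C: "C > 0" "\<forall>y\<in>im. \<exists>x. F x = y \<and> norm x \<le> C * norm y"
    using closed_range_bounded_preimage[OF im] .
  define D where "D = (1 + Cp) * (C * (1 + Cq))"
  \<comment> \<open>Subtracting the kernel component of a bounded preimage keeps its image and costs
    only the factor \<open>1 + Cp\<close>.\<close>
  have "\<exists>x. F x = y - q y \<and> x \<in> orthocomplement ipU ker \<and> norm x \<le> D * norm y" for y
  proof -
    obtain x where x: "F x = y - q y" "norm x \<le> C * norm (y - q y)"
      using C(2) q_im by blast
    have "norm (x - p x) \<le> (1 + Cp) * norm x"
      using norm_triangle_ineq4[of x "p x"] Cp(1)[of x] by (simp add: algebra_simps)
    also have "\<dots> \<le> (1 + Cp) * (C * norm (y - q y))"
      using x(2) Cp(2) by (intro mult_left_mono) auto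
    also have "norm (y - q y) \<le> (1 + Cq) * norm y"
      using norm_triangle_ineq4[of y "q y"] Cq(1)[of y] by (simp add: algebra_simps)
    finally have "norm (x - p x) \<le> D * norm y"
      using Cp(2) C(1) by (simp add: D_def mult.assoc)
    moreover have "F (x - p x) = y - q y"
      using x(1) p(1)[of x] by (simp add: blinfun.diff_right)
    ultimately show ?thesis using p(2) by blast
  qed
  then obtain L where L: "\<And>y. F (L y) = y - q y" "\<And>y. L y \<in> orthocomplement ipU ker"
    "\<And>y. norm (L y) \<le> D * norm y"
    by metis
  \<comment> \<open>The adjoint of \<open>L\<close> inverts \<open>Fa\<close> on the complement of
    the kernel, with values in the range of \<open>F\<close>.\<close>
  have "\<forall>x. \<exists>m. m \<in> im \<and> x - p x = Fa m"
    using adjoint_surj[OF im p(2)] by (simp add: image_iff Bex_def)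
  from choice[OF this] obtain La where La: "\<forall>x. La x \<in> im \<and> x - p x = Fa (La x)" ..
  have L_adj: "ipU (L y) x = ipV y (La x)" for x y
  proof -
    have "ipU (L y) (p x) = 0"
      using L(2)[of y] p(1)[of x] unfolding orthocomplement_def by blast
    then have "ipU (L y) x = ipU (L y) (x - p x)"
      by (simp add: U.ip.diff_right)
    also have "\<dots> = ipU (L y) (Fa (La x))"
      using La by simp
    also have "\<dots> = ipV (y - q y) (La x)"
      by (simp add: L(1) flip: adjoint)
    also have "ipV (q y) (La x) = 0"
      using q(1)[of y] La unfolding orthocomplement_def by blast
    then have "ipV (y - q y) (La x) = ipV y (La x)"
      by (simp add: V.ip.diff_left)
    finally show ?thesis .
  qed
  obtain G where G: "G \<in> adjointable_hom A actV ipV actU ipU" "blinfun_apply G = L"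
    by (rule rev.adjointable_hom_exists[of L La D, OF L_adj L(3)])
  \<comment> \<open>Both sides have the same image under \<open>F\<close> and are orthogonal to the
    kernel, so their difference lies in the kernel and in its complement.\<close>
  have GF: "L (F x) = x - p x" for x
  proof -
    have "L (F x) - (x - p x) \<in> orthocomplement ipU ker"
      by (intro U.submodule_diff[OF U.submodule_orthocomplement] L(2) p(2))
    moreover have "L (F x) - (x - p x) \<in> ker"
      using p(1)[of x] by (simp add: blinfun.diff_right L(1) q0)
    ultimately have "L (F x) - (x - p x) = 0"
      by (rule U.orthocomplement_disjoint[rotated])
    then show ?thesis by simp
  qed
  have PU: "(G o\<^sub>L F) - id_blinfun \<in> compact_hom A actU ipU actU ipU"
    by (rule U.neg_finite_proj_compact_hom[OF S(2)]) (simp add: blinfun.diff_left G(2) GF p_def)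
  have PV: "(F o\<^sub>L G) - id_blinfun \<in> compact_hom A actV ipV actV ipV"
    by (rule V.neg_finite_proj_compact_hom[OF T(2)]) (simp add: blinfun.diff_left G(2) L(1) q_def)
  show ?thesis
    unfolding fredholm_hom_def mem_Collect_eq
    by (intro conjI F bexI[OF _ G(1)] bexI[OF _ PU] bexI[OF _ PV]) simp_all
qed

end

theorem corollary5:
  fixes A :: "('h::chilbert_space \<Rightarrow>\<^sub>L 'h) set"
    and actU :: "'u::{complex_normed_vector, banach} \<Rightarrow> ('h \<Rightarrow>\<^sub>L 'h) \<Rightarrow> 'u"
    and ipU :: "'u \<Rightarrow> 'u \<Rightarrow> ('h \<Rightarrow>\<^sub>L 'h)"
    and actV :: "'v::{complex_normed_vector, banach} \<Rightarrow> ('h \<Rightarrow>\<^sub>L 'h) \<Rightarrow> 'v"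
    and ipV :: "'v \<Rightarrow> 'v \<Rightarrow> ('h \<Rightarrow>\<^sub>L 'h)"
    and F :: "'u \<Rightarrow>\<^sub>L 'v"
  assumes "compact_operator_cstar_algebra A"
    and "hilbert_module A actU ipU"
    and "hilbert_module A actV ipV"
    and "F \<in> adjointable_hom A actU ipU actV ipV"
  shows "F \<in> fredholm_hom A actU ipU actV ipV \<longleftrightarrow>
    closed (range (blinfun_apply F)) \<and>
    BNF_Cardinal_Arithmetic.cfinite (module_dim A actU ipU {u. F u = 0}) \<and>
    BNF_Cardinal_Arithmetic.cfinite (module_dim A actV ipV (orthocomplement ipV (range (blinfun_apply F))))"
proof -
  obtain Fa where Fa: "\<And>u v. ipV (F u) v = ipU u (Fa v)"
    using assms(4) unfolding adjointable_hom_def by blast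
  have U: "compact_hilbert_module A actU ipU" and V: "compact_hilbert_module A actV ipV"
    using assms(1-3) by (simp_all add: compact_hilbert_module_def)
  interpret adjointable_morphism A actU ipU actV ipV F Fa
    by (intro adjointable_morphism.intro hilbert_module_pair.intro adjointable_morphism_axioms.intro U V Fa)
  \<comment> \<open>\<open>S\<close>, and likewise \<open>T\<close> below, is the basis chosen in
    the definition of the dimension, so a finite dimension means that this set is finite.\<close>
  obtain S where S: "orthonormal_basis A actU ipU ker S" "BNF_Cardinal_Arithmetic.cfinite (module_dim A actU ipU ker) \<longleftrightarrow> finite S"
    using U.module_dim_finite_iff[OF submodule_ker closed_ker] .
  obtain T where T: "orthonormal_basis A actV ipV (orthocomplement ipV im) T"
    "BNF_Cardinal_Arithmetic.cfinite (module_dim A actV ipV (orthocomplement ipV im)) \<longleftrightarrow> finite T"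
    using V.module_dim_finite_iff[OF V.submodule_orthocomplement V.closed_orthocomplement] .
  show ?thesis
    unfolding S(2) T(2)
  proof
    assume "F \<in> fredholm_hom A actU ipU actV ipV"
    then obtain GU GV PU PV where P: "PU \<in> compact_hom A actU ipU actU ipU" "PV \<in> compact_hom A actV ipV actV ipV"
      and G: "GU o\<^sub>L F = id_blinfun + PU" "F o\<^sub>L GV = id_blinfun + PV"
      unfolding fredholm_hom_def by blast
    have "finite S"
    proof (rule U.finite_orthonormal_system[OF P(1)])
      show "U.orthonormal_system S" using S(1) by (simp only: U.orthonormal_basis_iff)
      fix u assume "u \<in> S"
      then have "F u = 0" using S(1) by (auto simp: orthonormal_basis_def)
      then have "u + PU u = 0"
        using arg_cong[OF G(1), of "\<lambda>T. blinfun_apply T u"] by (simp add: blinfun.add_left)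
      then show "ipU u (u + PU u) = 0" by (simp add: U.ip.zero_right)
    qed
    moreover have "finite T"
    proof (rule V.finite_orthonormal_system[OF P(2)])
      show "V.orthonormal_system T" using T(1) by (simp only: V.orthonormal_basis_iff)
      fix u assume "u \<in> T"
      \<comment> \<open>\<open>u + PV u\<close> equals \<open>F (GV u)\<close> and so lies in the
        range, to which \<open>u\<close> is orthogonal.\<close>
      then have "ipV u (F (GV u)) = 0" using T(1) by (auto simp: orthonormal_basis_def orthocomplement_def)
      then show "ipV u (u + PV u) = 0"
        using arg_cong[OF G(2), of "\<lambda>T. blinfun_apply T u"] by (simp add: blinfun.add_left)
    qed
    ultimately show "closed im \<and> finite S \<and> finite T"
      using closed_range_if_left_inverse[OF P(1) G(1)] by blast
  next
    assume "closed im \<and> finite S \<and> finite T"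
    then show "F \<in> fredholm_hom A actU ipU actV ipV"
      using fredholm_if_finite[OF assms(4) _ S(1) _ T(1)] by blast
  qed
qed

end
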